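(* Let $m\ge 2$, $q\ge 2$ be integers, let $\Omega$ be a nonempty closed subset of $\Sigma_m$, and let $$X_\Omega := \{x=(x_k)_{k=1}^\infty\in\Sigma_m:\ (x_{iq^\ell})_{\ell=0}^\infty\in\Omega\ \text{for all } i\ge 1 \text{ with } q\nmid i\}.$$ Let $\overline{t}=(t_u)_{u\in\mathrm{Pref}(\Omega)}$ be the unique vector in $[1,m^{1/(q-1)}]^{\mathrm{Pref}(\Omega)}$ with $t_u^q=\sum_{j:\ uj\in\mathrm{Pref}(\Omega)} t_{uj}$ for every $u\in\mathrm{Pref}(\Omega)$. Then (i) $\dim_H(X_\Omega) = (q-1)\log_m t_\varnothing$; (ii) the Minkowski dimension of $X_\Omega$ exists and $$\dim_M(X_\Omega) = (q-1)^2\sum_{k=1}^\infty \frac{\log_m|\mathrm{Pref}_k(\Omega)|}{q^{k+1}}.$$ Moreover, $\dim_H(X_\Omega)=\dim_M(X_\Omega)$ if and only if the tree of prefixes of $\Omega$ is spherically symmetric, i.e. for every $k\ge 1$ all $u\in\mathrm{Pref}_k(\Omega)$ have the same number of $j\in\{0,\dots,m-1\}$ with $uj\in\mathrm{Pref}_{k+1}(\Omega)$.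
   Context: $\Sigma_m=\{0,\dots,m-1\}^{\mathbb N}$ with metric $\varrho((x_k),(y_k)) = m^{-\min\{n:\ x_n\ne y_n\}+1}$; dimensions are taken with respect to this metric. For a word $u$, $[u]$ is the cylinder of sequences beginning with $u$. $\mathrm{Pref}_0(\Omega)=\{\varnothing\}$ (empty word), $\mathrm{Pref}_k(\Omega)=\{u\in\{0,\dots,m-1\}^k:\ \Omega\cap[u]\neq\emptyset\}$, $\mathrm{Pref}(\Omega)=\bigcup_{k\ge0}\mathrm{Pref}_k(\Omega)$. The tree of prefixes $\Gamma(\Omega)$ has vertex set $\mathrm{Pref}(\Omega)$ and a directed edge from $u$ to $uj$ whenever both are prefixes ($j\in\{0,\dots,m-1\}$); $uj$ denotes concatenation. $\log_m$ is logarithm base $m$. *)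

theory Defs
  imports "HOL-Analysis.Analysis"
begin

text \<open>Sequences in Sigma_m are represented 0-based: the paper's coordinate x_k (k >= 1)
  is x (k - 1). Words are nat lists.\<close>

definition sigma :: "nat \<Rightarrow> (nat \<Rightarrow> nat) set" where
  "sigma m = {x. \<forall>k. x k < m}"

text \<open>Metric: rho(x,y) = m^(-min{n : x_n ~= y_n} + 1) with 1-based n, i.e. m^(-n0) with n0 the
  0-based first index of disagreement.\<close>
definition rho :: "nat \<Rightarrow> (nat \<Rightarrow> nat) \<Rightarrow> (nat \<Rightarrow> nat) \<Rightarrow> real" where
  "rho m x y = (if x = y then 0 else real m powr (- real (LEAST n. x n \<noteq> y n)))"

definition sdiam :: "nat \<Rightarrow> (nat \<Rightarrow> nat) set \<Rightarrow> real" where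
  "sdiam m A = (if A = {} then 0 else (SUP x\<in>A. SUP y\<in>A. rho m x y))"

definition closed_in_sigma :: "nat \<Rightarrow> (nat \<Rightarrow> nat) set \<Rightarrow> bool" where
  "closed_in_sigma m A \<longleftrightarrow> A \<subseteq> sigma m \<and>
     (\<forall>x\<in>sigma m. (\<forall>e>0. \<exists>y\<in>A. rho m x y < e) \<longrightarrow> x \<in> A)"

definition hausdorff_delta :: "nat \<Rightarrow> real \<Rightarrow> real \<Rightarrow> (nat \<Rightarrow> nat) set \<Rightarrow> ennreal" where
  "hausdorff_delta m s \<delta> A =
     (INF U \<in> {U :: nat \<Rightarrow> (nat \<Rightarrow> nat) set.
                 (\<forall>i. U i \<subseteq> sigma m \<and> sdiam m (U i) \<le> \<delta>) \<and> A \<subseteq> (\<Union>i. U i)}.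
        (\<Sum>i. ennreal (sdiam m (U i) powr s)))"

definition hausdorff_measure :: "nat \<Rightarrow> real \<Rightarrow> (nat \<Rightarrow> nat) set \<Rightarrow> ennreal" where
  "hausdorff_measure m s A = (SUP \<delta>\<in>{0<..}. hausdorff_delta m s \<delta> A)"

definition hausdorff_dim :: "nat \<Rightarrow> (nat \<Rightarrow> nat) set \<Rightarrow> real" where
  "hausdorff_dim m A = Inf {s. s > 0 \<and> hausdorff_measure m s A = 0}"

definition cover_number :: "nat \<Rightarrow> (nat \<Rightarrow> nat) set \<Rightarrow> real \<Rightarrow> nat" where
  "cover_number m A e = Inf {card F | F. finite F \<and> (\<forall>U\<in>F. U \<subseteq> sigma m \<and> sdiam m U \<le> e)
                                      \<and> A \<subseteq> \<Union>F}"

definition has_minkowski_dim :: "nat \<Rightarrow> (nat \<Rightarrow> nat) set \<Rightarrow> real \<Rightarrow> bool" where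
  "has_minkowski_dim m A d \<longleftrightarrow>
     ((\<lambda>e. ln (real (cover_number m A e)) / - ln e) \<longlongrightarrow> d) (at_right 0)"

definition Pref_k :: "nat \<Rightarrow> (nat \<Rightarrow> nat) set \<Rightarrow> nat \<Rightarrow> nat list set" where
  "Pref_k m \<Omega> k = {u. length u = k \<and> (\<forall>i<k. u ! i < m) \<and> (\<exists>x\<in>\<Omega>. \<forall>i<k. x i = u ! i)}"

definition Pref :: "nat \<Rightarrow> (nat \<Rightarrow> nat) set \<Rightarrow> nat list set" where
  "Pref m \<Omega> = (\<Union>k. Pref_k m \<Omega> k)"

definition X_set :: "nat \<Rightarrow> nat \<Rightarrow> (nat \<Rightarrow> nat) set \<Rightarrow> (nat \<Rightarrow> nat) set" where
  "X_set m q \<Omega> = {x \<in> sigma m. \<forall>i\<ge>1. \<not> q dvd i \<longrightarrow> (\<lambda>l. x (i * q ^ l - 1)) \<in> \<Omega>}"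

definition spherically_symmetric :: "nat \<Rightarrow> (nat \<Rightarrow> nat) set \<Rightarrow> bool" where
  "spherically_symmetric m \<Omega> \<longleftrightarrow>
     (\<forall>k\<ge>1. \<forall>u\<in>Pref_k m \<Omega> k. \<forall>v\<in>Pref_k m \<Omega> k.
        card {j. j < m \<and> u @ [j] \<in> Pref_k m \<Omega> (Suc k)} =
        card {j. j < m \<and> v @ [j] \<in> Pref_k m \<Omega> (Suc k)})"

end

theory Submission
  imports Defs "HOL-Real_Asymp.Real_Asymp"
begin

text \<open>
  Give the cylinder of \<open>w\<close> in \<open>\<Omega>\<close> the mass \<open>mu w\<close> of the Markov-like measure with transition
  probabilities \<open>t (u @ [a]) / t u ^ q\<close>, and let \<open>p\<close> be the product of these measures over the
  disjoint chains \<open>i, i q, i q\<^sup>2, \<dots>\<close> (with \<open>q\<close> not dividing \<open>i\<close>) of coordinates of \<open>X\<close>.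

  The words of length \<open>n\<close> in \<open>X\<close> are independent choices of prefixes of \<open>\<Omega>\<close>, one per chain, and a
  proportion \<open>(q - 1)\<^sup>2 / q ^ (k + 1)\<close> of \<open>1, \<dots>, n\<close> starts a chain of length \<open>k\<close>; this gives
  the Minkowski dimension. By the equation for \<open>t\<close>, \<open>- ln (p (x|n)) / n\<close> equals
  \<open>(q - 1) ln (t [])\<close> plus a difference of bounded averages that telescopes along \<open>n = q ^ k\<close>, so
  every \<open>x\<close> has infinitely many prefixes of mass at least about \<open>t [] powr (- (q - 1) n)\<close>, which
  bounds the Hausdorff dimension from above. For the lower bound, the words of much larger mass have
  exponentially small total mass: the sum of \<open>p (u) powr (1 + \<theta>)\<close> factorises over the chains, and its
  exponential rate is \<open>- \<theta> (q - 1)\<^sup>2 \<Sum> H k / q ^ (k + 1) + O(\<theta>\<^sup>2)\<close> with \<open>H k\<close> the entropy of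
  \<open>mu\<close> on words of length \<open>k\<close>, where \<open>(q - 1) \<Sum> H k / q ^ (k + 1) = ln (t [])\<close>.

  The last identity also compares the two dimensions: \<open>H k \<le> ln (card (Pref_k k))\<close> with equality
  iff \<open>mu\<close> is uniform on words of length \<open>k\<close>, and \<open>mu\<close> is uniform at all levels iff the tree is
  spherically symmetric.
\<close>

section \<open>Prefixes, cylinders and diameters\<close>

definition pre :: "(nat \<Rightarrow> nat) \<Rightarrow> nat \<Rightarrow> nat list" where
  "pre x n = map x [0..<n]"

lemma length_pre [simp]: "length (pre x n) = n"
  by (simp add: pre_def)

lemma nth_pre [simp]: "i < n \<Longrightarrow> pre x n ! i = x i"
  by (simp add: pre_def)

lemma pre_0 [simp]: "pre x 0 = []"
  by (simp add: pre_def)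

lemma pre_Suc: "pre x (Suc n) = pre x n @ [x n]"
  by (simp add: pre_def)

lemma take_pre: "k \<le> n \<Longrightarrow> take k (pre x n) = pre x k"
  by (simp add: pre_def take_map)

lemma pre_eq_iff: "pre x n = pre y n \<longleftrightarrow> (\<forall>k<n. x k = y k)"
  by (auto simp: pre_def)

text \<open>The letter bound in \<open>Pref_k\<close> is automatic inside \<open>sigma m\<close>, so
  prefixes become an image. This is how a point witnessing a prefix is obtained throughout.\<close>

lemma Pref_k_eq_image:
  assumes "A \<subseteq> sigma m"
  shows "Pref_k m A n = (\<lambda>x. pre x n) ` A"
proof
  show "Pref_k m A n \<subseteq> (\<lambda>x. pre x n) ` A"
  proof
    fix u assume "u \<in> Pref_k m A n"
    then obtain x where "x \<in> A" "length u = n" "\<forall>i<n. x i = u ! i"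
      by (auto simp: Pref_k_def)
    then show "u \<in> (\<lambda>x. pre x n) ` A"
      by (intro image_eqI[of _ _ x]) (auto intro: nth_equalityI)
  qed
  show "(\<lambda>x. pre x n) ` A \<subseteq> Pref_k m A n"
    using assms by (auto simp: Pref_k_def sigma_def)
qed

lemma Pref_iff: "u \<in> Pref m A \<longleftrightarrow> u \<in> Pref_k m A (length u)"
  by (auto simp: Pref_def Pref_k_def)

lemma Pref_kD: "u \<in> Pref_k m A n \<Longrightarrow> length u = n \<and> u \<in> Pref m A"
  by (auto simp: Pref_iff) (auto simp: Pref_k_def)

lemma finite_Pref_k [simp]: "finite (Pref_k m A n)"
proof (rule finite_subset)
  show "Pref_k m A n \<subseteq> {u. set u \<subseteq> {..<m} \<and> length u = n}"
    by (auto simp: Pref_k_def in_set_conv_nth)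
  show "finite {u :: nat list. set u \<subseteq> {..<m} \<and> length u = n}"
    by (rule finite_lists_length_eq) simp
qed

lemma Pref_k_0: "A \<noteq> {} \<Longrightarrow> Pref_k m A 0 = {[]}"
  by (auto simp: Pref_k_def)

definition children :: "nat \<Rightarrow> (nat \<Rightarrow> nat) set \<Rightarrow> nat list \<Rightarrow> nat set" where
  "children m A u = {a. a < m \<and> u @ [a] \<in> Pref m A}"

lemma finite_children [simp]: "finite (children m A u)"
  by (simp add: children_def)

lemma Pref_snocD: "u @ [a] \<in> Pref m A \<Longrightarrow> u \<in> Pref m A \<and> a < m"
proof -
  assume *: "u @ [a] \<in> Pref m A"
  then obtain x where x: "x \<in> A" "\<forall>i<Suc (length u). x i = (u @ [a]) ! i"
    by (auto simp: Pref_iff Pref_k_def)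
  have lt: "(u @ [a]) ! i < m" if "i < Suc (length u)" for i
    using that * by (auto simp: Pref_iff Pref_k_def)
  have "u ! i < m" "x i = u ! i" if "i < length u" for i
    using lt[of i] x(2) that by (auto simp: nth_append)
  then show ?thesis using x(1) lt[of "length u"] by (auto simp: Pref_iff Pref_k_def)
qed

lemma snoc_Pref_k_iff:
  "u @ [a] \<in> Pref_k m A (Suc n) \<longleftrightarrow> u \<in> Pref_k m A n \<and> a \<in> children m A u"
proof
  assume *: "u @ [a] \<in> Pref_k m A (Suc n)"
  then have "length u = n" "u @ [a] \<in> Pref m A" by (auto dest: Pref_kD)
  then show "u \<in> Pref_k m A n \<and> a \<in> children m A u"
    using Pref_snocD[of u a m A] by (auto simp: children_def Pref_iff)
next
  assume "u \<in> Pref_k m A n \<and> a \<in> children m A u"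
  then show "u @ [a] \<in> Pref_k m A (Suc n)"
    by (auto simp: children_def Pref_iff dest: Pref_kD)
qed

text \<open>Every word of length \<open>Suc n\<close> splits uniquely into its parent and its last
  letter. All passages from one level of the tree to the next use this identity.\<close>

lemma sum_Pref_k_Suc:
  "(\<Sum>u\<in>Pref_k m A (Suc n). F u) = (\<Sum>u\<in>Pref_k m A n. \<Sum>a\<in>children m A u. F (u @ [a]))"
proof -
  have "(\<Sum>u\<in>Pref_k m A n. \<Sum>a\<in>children m A u. F (u @ [a])) =
        (\<Sum>(u, a)\<in>(SIGMA u:Pref_k m A n. children m A u). F (u @ [a]))"
    by (simp add: sum.Sigma)
  also have "\<dots> = (\<Sum>u\<in>Pref_k m A (Suc n). F u)"
  proof (rule sum.reindex_bij_witness[where i = "\<lambda>u. (butlast u, last u)" and j = "\<lambda>(u, a). u @ [a]"])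
    fix u assume u: "u \<in> Pref_k m A (Suc n)"
    then have "u \<noteq> []" by (auto simp: Pref_k_def)
    then have "butlast u @ [last u] = u" by simp
    with u show "(butlast u, last u) \<in> (SIGMA u:Pref_k m A n. children m A u)"
      "(case (butlast u, last u) of (u, a) \<Rightarrow> u @ [a]) = u"
      using snoc_Pref_k_iff[of "butlast u" "last u" m A n] by auto
  qed (auto simp: snoc_Pref_k_iff)
  finally show ?thesis by simp
qed

text \<open>The tree has no leaves: a point witnessing \<open>u\<close> supplies a next
  letter.\<close>

lemma children_nonempty:
  assumes "A \<subseteq> sigma m" "u \<in> Pref m A"
  shows "children m A u \<noteq> {}"
proof -
  from assms obtain x where x: "x \<in> A" "u = pre x (length u)"
    by (auto simp: Pref_iff Pref_k_eq_image)
  then have "pre x (Suc (length u)) \<in> Pref_k m A (Suc (length u))"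
    using assms(1) by (auto simp: Pref_k_eq_image)
  then show ?thesis using x(2) snoc_Pref_k_iff[of u "x (length u)"] by (auto simp: pre_Suc)
qed

lemma card_children_le: "card (children m A u) \<le> m"
  using card_mono[of "{..<m}" "children m A u"] by (auto simp: children_def)

lemma card_Pref_k_Suc: "card (Pref_k m A (Suc n)) = (\<Sum>u\<in>Pref_k m A n. card (children m A u))"
  using sum_Pref_k_Suc[of "\<lambda>_. 1::nat" m A n] by simp

section \<open>The metric, diameters and cylinders\<close>

lemma rho_le_iff:
  assumes "m \<ge> 2"
  shows "rho m x y \<le> real m powr (- real n) \<longleftrightarrow> (\<forall>k<n. x k = y k)"
proof (cases "x = y")
  case False
  let ?L = "LEAST n. x n \<noteq> y n"
  from False obtain k where "x k \<noteq> y k" by auto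
  then have L: "x ?L \<noteq> y ?L" by (rule LeastI)
  have L': "x k = y k" if "k < ?L" for k using not_less_Least[OF that] by simp
  have "rho m x y \<le> real m powr (- real n) \<longleftrightarrow> n \<le> ?L"
    using False assms by (simp add: rho_def)
  also have "\<dots> \<longleftrightarrow> (\<forall>k<n. x k = y k)"
    using L L' by (meson leI order.strict_trans2)
  finally show ?thesis .
qed (simp add: rho_def)

text \<open>Nonzero distances are powers of \<open>m\<close>, so a distance below
  \<open>m powr (1 - n)\<close> is already at most \<open>m powr (- n)\<close>. This form serves
  sets whose diameter is only known up to a factor \<open>m\<close>.\<close>

lemma rho_less_imp_agree:
  assumes "m \<ge> 2" "rho m x y < real m powr (1 - real n)"
  shows "\<forall>k<n. x k = y k"
proof (cases "x = y")
  case False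
  let ?L = "LEAST n. x n \<noteq> y n"
  from False assms have "n \<le> ?L" by (simp add: rho_def)
  have "x k = y k" if "k < ?L" for k using not_less_Least[OF that] by simp
  with \<open>n \<le> ?L\<close> show ?thesis by (meson order.strict_trans2)
qed simp

lemma rho_nonneg: "rho m x y \<ge> 0"
  by (simp add: rho_def)

lemma rho_le_1: "m \<ge> 2 \<Longrightarrow> rho m x y \<le> 1"
  using rho_le_iff[of m x y 0] by simp

lemma bdd_rho: "m \<ge> 2 \<Longrightarrow> bdd_above ((\<lambda>y. rho m x y) ` A)"
  by (auto intro!: bdd_aboveI[of _ 1] rho_le_1)

lemma SUP_rho_le_1: "m \<ge> 2 \<Longrightarrow> A \<noteq> {} \<Longrightarrow> (SUP y\<in>A. rho m x y) \<le> 1"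
  by (rule cSUP_least) (auto simp: rho_le_1)

lemma rho_le_sdiam:
  assumes "m \<ge> 2" "x \<in> U" "y \<in> U"
  shows "rho m x y \<le> sdiam m U"
proof -
  have ne: "U \<noteq> {}" using assms by auto
  have "rho m x y \<le> (SUP y\<in>U. rho m x y)"
    using assms by (intro cSUP_upper bdd_rho)
  also have "\<dots> \<le> (SUP x\<in>U. SUP y\<in>U. rho m x y)"
    using assms ne
    by (intro cSUP_upper[of x U "\<lambda>x. SUP y\<in>U. rho m x y"]) (auto intro!: bdd_aboveI[of _ 1] SUP_rho_le_1)
  finally show ?thesis using ne by (simp add: sdiam_def)
qed

lemma sdiam_nonneg: "m \<ge> 2 \<Longrightarrow> sdiam m U \<ge> 0"
proof (cases "U = {}")
  case False
  assume "m \<ge> 2"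
  then obtain x where "x \<in> U" using False by auto
  then show ?thesis using order_trans[OF rho_nonneg[of m x x] rho_le_sdiam[OF \<open>m \<ge> 2\<close>]] by simp
qed (simp add: sdiam_def)

lemma sdiam_le:
  assumes "e \<ge> 0" "\<And>x y. x \<in> U \<Longrightarrow> y \<in> U \<Longrightarrow> rho m x y \<le> e"
  shows "sdiam m U \<le> e"
  using assms by (auto simp: sdiam_def intro!: cSUP_least)

definition cyl :: "nat \<Rightarrow> nat list \<Rightarrow> (nat \<Rightarrow> nat) set" where
  "cyl m u = {x \<in> sigma m. pre x (length u) = u}"

lemma sdiam_cyl_le: "m \<ge> 2 \<Longrightarrow> sdiam m (cyl m u) \<le> real m powr (- real (length u))"
proof (rule sdiam_le, simp)
  fix x y assume "m \<ge> 2" "x \<in> cyl m u" "y \<in> cyl m u"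
  then show "rho m x y \<le> real m powr (- real (length u))"
    by (subst rho_le_iff) (auto simp: cyl_def pre_eq_iff[symmetric])
qed

lemma powr_neg_eventually_le:
  assumes "m \<ge> 2" "d > 0"
  obtains N where "\<And>n. n \<ge> N \<Longrightarrow> real m powr (- real n) \<le> d"
proof -
  have "(\<lambda>n. real m powr (- real n)) \<longlonglongrightarrow> 0"
    using assms by real_asymp
  then have "eventually (\<lambda>n. real m powr (- real n) < d) sequentially"
    using assms order_tendstoD(2) by blast
  then show ?thesis using that by (auto simp: eventually_sequentially intro: less_imp_le)
qed

text \<open>Balls are cylinders, so closedness becomes a statement about agreement of finite
  prefixes.\<close>

lemma closed_in_sigma_iff:
  assumes "m \<ge> 2"
  shows "closed_in_sigma m A \<longleftrightarrow>
    A \<subseteq> sigma m \<and> (\<forall>x\<in>sigma m. (\<forall>n. \<exists>y\<in>A. \<forall>k<n. x k = y k) \<longrightarrow> x \<in> A)"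
proof -
  have "(\<forall>e>0. \<exists>y\<in>A. rho m x y < e) \<longleftrightarrow> (\<forall>n. \<exists>y\<in>A. \<forall>k<n. x k = y k)" for x
  proof (intro iffI allI impI)
    fix n assume "\<forall>e>0. \<exists>y\<in>A. rho m x y < e"
    then obtain y where "y \<in> A" "rho m x y < real m powr (- real n)"
      using assms by (auto dest!: spec[of _ "real m powr (- real n)"])
    then show "\<exists>y\<in>A. \<forall>k<n. x k = y k" using rho_le_iff[OF assms] less_imp_le by metis
  next
    fix e :: real assume *: "\<forall>n. \<exists>y\<in>A. \<forall>k<n. x k = y k" "e > 0"
    obtain N where N: "real m powr (- real N) \<le> e / 2"
      using powr_neg_eventually_le[OF assms half_gt_zero[OF *(2)]] by blast
    from * obtain y where y: "y \<in> A" "\<forall>k<N. x k = y k" by blast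
    then have "rho m x y \<le> real m powr (- real N)" using rho_le_iff[OF assms] by blast
    with N *(2) y(1) show "\<exists>y\<in>A. rho m x y < e" by (intro bexI[of _ y]) auto
  qed
  then show ?thesis by (simp add: closed_in_sigma_def)
qed

section \<open>Bounds for Minkowski and Hausdorff dimension from prefix counts and weights\<close>

lemma mem_closed_if_prefixes:
  assumes "m \<ge> 2" "closed_in_sigma m A" "\<And>n. pre x n \<in> Pref_k m A n"
  shows "x \<in> A"
proof -
  have A: "A \<subseteq> sigma m" using assms by (simp add: closed_in_sigma_def)
  have ex: "\<exists>y\<in>A. \<forall>k<n. x k = y k" for n
    using assms(3)[of n] A by (auto simp: Pref_k_eq_image pre_eq_iff)
  have "x k < m" for k using ex[of "Suc k"] A by (auto simp: sigma_def)
  then show ?thesis using ex assms closed_in_sigma_iff by (auto simp: sigma_def)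
qed

text \<open>The cylinders of length \<open>n\<close> form an optimal cover: points of one set of
  diameter at most \<open>e\<close> share their first \<open>n\<close> letters, so distinct prefixes
  require distinct covering sets.\<close>

lemma cover_number_eq:
  assumes m: "m \<ge> 2" and A: "A \<subseteq> sigma m"
    and e: "real m powr (- real n) \<le> e" "e < real m powr (1 - real n)"
  shows "cover_number m A e = card (Pref_k m A n)"
proof -
  define C where "C = {card F | F. finite F \<and> (\<forall>U\<in>F. U \<subseteq> sigma m \<and> sdiam m U \<le> e) \<and> A \<subseteq> \<Union>F}"
  let ?F = "cyl m ` Pref_k m A n"
  have "sdiam m U \<le> e" if "U \<in> ?F" for U
    using that sdiam_cyl_le[OF m] e(1) by (fastforce simp: Pref_k_def intro: order_trans)
  moreover have "A \<subseteq> \<Union>?F"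
    using A by (auto simp: Pref_k_eq_image cyl_def)
  ultimately have "card ?F \<in> C"
    unfolding C_def by (intro CollectI exI[of _ ?F]) (auto simp: cyl_def)
  then have "Inf C \<le> card (Pref_k m A n)" and "C \<noteq> {}"
    by (auto intro!: order_trans[OF cInf_lower card_image_le])
  moreover have "card (Pref_k m A n) \<le> c" if c: "c \<in> C" for c
  proof -
    from c obtain F where F: "c = card F" "finite F" "\<And>U. U \<in> F \<Longrightarrow> sdiam m U \<le> e" "A \<subseteq> \<Union>F"
      by (auto simp: C_def)
    have "\<forall>u\<in>Pref_k m A n. \<exists>x U. x \<in> U \<and> pre x n = u \<and> U \<in> F"
    proof
      fix u assume "u \<in> Pref_k m A n"
      then obtain x where x: "x \<in> A" "u = pre x n" using A by (auto simp: Pref_k_eq_image)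
      with F(4) obtain U where "x \<in> U" "U \<in> F" by auto
      with x show "\<exists>x U. x \<in> U \<and> pre x n = u \<and> U \<in> F" by metis
    qed
    then obtain x U where xU: "\<And>u. u \<in> Pref_k m A n \<Longrightarrow> x u \<in> U u \<and> pre (x u) n = u \<and> U u \<in> F"
      by metis
    have "inj_on U (Pref_k m A n)"
    proof (rule inj_onI)
      fix u v assume uv: "u \<in> Pref_k m A n" "v \<in> Pref_k m A n" "U u = U v"
      have "rho m (x u) (x v) \<le> sdiam m (U u)"
        using uv xU[of u] xU[of v] by (intro rho_le_sdiam m) auto
      also have "\<dots> \<le> e" using uv xU F(3) by blast
      finally have "\<forall>k<n. x u k = x v k"
        using e(2) by (intro rho_less_imp_agree[OF m]) auto
      then show "u = v" using uv(1,2) xU by (metis pre_eq_iff)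
    qed
    then show ?thesis
      unfolding F(1) using xU F(2) by (intro card_inj_on_le[of U]) auto
  qed
  ultimately have "Inf C = card (Pref_k m A n)"
    by (intro antisym cInf_greatest) auto
  then show ?thesis by (simp add: cover_number_def C_def)
qed

text \<open>By \<open>cover_number_eq\<close> the cover number is constant on each scale interval
  between consecutive powers of \<open>m\<close>, so the limit in \<open>e\<close> reduces to a
  limit in \<open>n\<close>.\<close>

lemma has_minkowski_dim_if_limit:
  assumes m: "m \<ge> 2" and A: "A \<subseteq> sigma m"
    and lim: "(\<lambda>n. ln (real (card (Pref_k m A n))) / real n) \<longlonglongrightarrow> d * ln (real m)"
  shows "has_minkowski_dim m A d"
proof -
  \<comment> \<open>For \<open>e < 1\<close> this is the least \<open>n\<close> with
    \<open>m powr (- n) <= e\<close>; it is asymptotic to \<open>- log m e\<close>.\<close>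
  define N where "N = (\<lambda>e. nat \<lceil>- log (real m) e\<rceil>)"
  have ev: "eventually (\<lambda>e::real. 0 < e \<and> e < 1) (at_right 0)"
    by (rule eventually_at_rightI[of 0 1]) auto
  have lnm: "ln (real m) > 0" using m by simp
  have cov: "cover_number m A e = card (Pref_k m A (N e))" if "0 < e \<and> e < 1" for e
  proof (rule cover_number_eq[OF m A])
    have pos: "- log (real m) e > 0" using that m by simp
    have 1: "- log (real m) e \<le> real (N e)" unfolding N_def by (rule real_nat_ceiling_ge)
    have 2: "real (N e) < 1 - log (real m) e" using pos unfolding N_def by linarith
    have e: "e = real m powr (log (real m) e)" using that m by simp
    show "real m powr (- real (N e)) \<le> e"
      using 1 m by (subst e) (simp add: powr_le_cancel_iff)
    show "e < real m powr (1 - real (N e))"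
      using 2 m by (subst e) (simp add: powr_less_cancel_iff)
  qed
  have Ninf: "filterlim N at_top (at_right 0)"
    unfolding N_def using m by real_asymp
  have "((\<lambda>e. ln (real (card (Pref_k m A (N e)))) / real (N e)) \<longlongrightarrow> d * ln (real m)) (at_right 0)"
    by (rule filterlim_compose[OF lim Ninf])
  moreover have "((\<lambda>e. real (N e) / (- ln e)) \<longlongrightarrow> 1 / ln (real m)) (at_right 0)"
  proof -
    have "filterlim (\<lambda>e. - log (real m) e) at_top (at_right 0)"
      using m by real_asymp
    moreover have "((\<lambda>y. real (nat \<lceil>y\<rceil>) / y) \<longlongrightarrow> 1) at_top"
      by real_asymp
    ultimately have "((\<lambda>e. real (N e) / (- log (real m) e)) \<longlongrightarrow> 1) (at_right 0)"
      unfolding N_def by (rule filterlim_compose[rotated])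
    then have "((\<lambda>e. real (N e) / (- log (real m) e) / ln (real m)) \<longlongrightarrow> 1 / ln (real m)) (at_right 0)"
      using lnm by (intro tendsto_divide) auto
    then show ?thesis using lnm by (simp add: log_def)
  qed
  ultimately have "((\<lambda>e. ln (real (card (Pref_k m A (N e)))) / real (N e) * (real (N e) / (- ln e))) \<longlongrightarrow>
      d * ln (real m) * (1 / ln (real m))) (at_right 0)"
    by (rule tendsto_mult)
  then have "((\<lambda>e. ln (real (card (Pref_k m A (N e)))) / real (N e) * (real (N e) / (- ln e))) \<longlongrightarrow> d) (at_right 0)"
    using lnm by simp
  moreover have "eventually (\<lambda>e. ln (real (card (Pref_k m A (N e)))) / real (N e) * (real (N e) / (- ln e)) =
      ln (real (cover_number m A e)) / - ln e) (at_right 0)"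
    using ev eventually_compose_filterlim[OF eventually_gt_at_top[of 0] Ninf]
  proof eventually_elim
    case (elim e)
    then show ?case by (simp add: cov)
  qed
  ultimately show ?thesis
    unfolding has_minkowski_dim_def by (rule Lim_transform_eventually)
qed

text \<open>Summing over all words of length at least \<open>N\<close> avoids having to select disjoint cylinders.\<close>

lemma hausdorff_measure_eq_0:
  fixes p :: "nat list \<Rightarrow> real"
  assumes m: "m \<ge> 2" and A: "A \<subseteq> sigma m" and rs: "r < s"
    and p0: "\<And>u. u \<in> Pref m A \<Longrightarrow> p u \<ge> 0"
    and p1: "\<And>n. (\<Sum>u\<in>Pref_k m A n. p u) \<le> 1"
    and dense: "\<And>x N. x \<in> A \<Longrightarrow> \<exists>n\<ge>N. p (pre x n) \<ge> real m powr (- real n * r)"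
    and s: "s > 0"
  shows "hausdorff_measure m s A = 0"
proof -
  \<comment> \<open>The ratio of the geometric series:
    \<open>m powr (- n * s) = b ^ n * m powr (- n * r)\<close>, so a word of length \<open>n\<close>
    in \<open>W\<close> costs at most \<open>b ^ n\<close> times its mass.\<close>
  define b where "b = real m powr (- (s - r))"
  have b: "0 < b" "b < 1" using m rs by (auto simp: b_def powr_less_one)
  have "hausdorff_delta m s d A \<le> ennreal e" if d: "d > 0" and e: "e > 0" for d e :: real
  proof -
    obtain N1 where N1: "\<And>n. n \<ge> N1 \<Longrightarrow> real m powr (- real n) \<le> d"
      using powr_neg_eventually_le[OF m d] by blast
    have "(\<lambda>n. b ^ n * (1 / (1 - b))) \<longlonglongrightarrow> 0 * (1 / (1 - b))"
      using b by (intro tendsto_mult LIMSEQ_realpow_zero tendsto_const) auto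
    then have "eventually (\<lambda>n. b ^ n * (1 / (1 - b)) < e) sequentially"
      using e by (intro order_tendstoD) auto
    then obtain N2 where N2: "\<And>n. n \<ge> N2 \<Longrightarrow> b ^ n * (1 / (1 - b)) < e"
      by (auto simp: eventually_sequentially)
    define N where "N = max N1 N2"
    define W where "W = {u \<in> Pref m A. length u \<ge> N \<and> p u \<ge> real m powr (- real (length u) * r)}"
    define w where "w = from_nat_into (UNIV :: nat list set)"
    have "infinite (UNIV :: nat list set)" by (rule infinite_UNIV_listI)
    then have w: "bij w" unfolding w_def by (intro bij_betw_from_nat_into) auto
    \<comment> \<open>Covers must be indexed by the naturals, so all words are enumerated; a word
      outside \<open>W\<close> contributes the empty set, whose diameter is 0 by convention and
      whose cost is therefore 0.\<close>
    define U where "U = (\<lambda>i. if w i \<in> W then cyl m (w i) else {})"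
    have 1: "U i \<subseteq> sigma m \<and> sdiam m (U i) \<le> d" for i
    proof (cases "w i \<in> W")
      case True
      then have "real m powr (- real (length (w i))) \<le> d" using N1 by (auto simp: W_def N_def)
      then show ?thesis using True sdiam_cyl_le[OF m, of "w i"] by (auto simp: U_def cyl_def)
    next
      case False
      then show ?thesis using d by (auto simp: U_def sdiam_def)
    qed
    have 2: "A \<subseteq> (\<Union>i. U i)"
    proof
      fix x assume x: "x \<in> A"
      from dense[OF x, of N] obtain n where n: "n \<ge> N" "p (pre x n) \<ge> real m powr (- real n * r)" by blast
      have W: "pre x n \<in> W" using n x A unfolding W_def by (auto simp: Pref_iff Pref_k_eq_image)
      obtain i where i: "w i = pre x n" using w by (metis bij_pointE)
      have "x \<in> U i" using x A i W by (auto simp: U_def cyl_def)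
      then show "x \<in> (\<Union>i. U i)" by blast
    qed
    have level: "(\<Sum>u\<in>Pref_k m A n \<inter> W. real m powr (- real n * s)) \<le> b ^ n" for n
    proof -
      have "(\<Sum>u\<in>Pref_k m A n \<inter> W. real m powr (- real n * s)) \<le>
          (\<Sum>u\<in>Pref_k m A n \<inter> W. b ^ n * p u)"
      proof (rule sum_mono)
        fix u assume u: "u \<in> Pref_k m A n \<inter> W"
        then have "real m powr (- real n * r) \<le> p u" by (auto simp: W_def dest: Pref_kD)
        moreover have "real m powr (- real n * s) = b ^ n * real m powr (- real n * r)"
          using m by (simp add: b_def powr_realpow[symmetric] powr_powr powr_add[symmetric] algebra_simps)
        ultimately show "real m powr (- real n * s) \<le> b ^ n * p u" using b by simp
      qed
      also have "\<dots> = b ^ n * (\<Sum>u\<in>Pref_k m A n \<inter> W. p u)" by (simp add: sum_distrib_left)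
      also have "\<dots> \<le> b ^ n * (\<Sum>u\<in>Pref_k m A n. p u)"
        using b p0 by (intro mult_left_mono sum_mono2) (auto dest: Pref_kD)
      also have "\<dots> \<le> b ^ n * 1" using b p1 by (intro mult_left_mono) auto
      finally show ?thesis by simp
    qed
    \<comment> \<open>Finite partial sums suffice. Grouped by word length, they are bounded by the
      tail of the geometric series from \<open>N\<close> on.\<close>
    have part: "(\<Sum>i<M. ennreal (sdiam m (U i) powr s)) \<le> ennreal e" for M
    proof -
      define F where "F = w ` {..<M} \<inter> W"
      have finF: "finite F" by (simp add: F_def)
      obtain L where L: "\<And>u. u \<in> F \<Longrightarrow> length u < L"
        using finite_nat_set_iff_bounded[of "length ` F"] finF by auto
      have "(\<Sum>i<M. sdiam m (U i) powr s) \<le> (\<Sum>i<M. if w i \<in> W then real m powr (- real (length (w i)) * s) else 0)"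
      proof (rule sum_mono)
        fix i
        have "sdiam m (cyl m (w i)) powr s \<le> (real m powr (- real (length (w i)))) powr s"
          using s by (intro powr_mono2 sdiam_cyl_le m sdiam_nonneg) auto
        then show "sdiam m (U i) powr s \<le> (if w i \<in> W then real m powr (- real (length (w i)) * s) else 0)"
          by (cases "w i \<in> W") (simp_all add: U_def powr_powr, simp add: sdiam_def)
      qed
      also have "\<dots> = (\<Sum>u\<in>w ` {..<M}. if u \<in> W then real m powr (- real (length u) * s) else 0)"
        using w by (subst sum.reindex) (auto simp: bij_def intro: inj_on_subset)
      also have "\<dots> = (\<Sum>u\<in>F. real m powr (- real (length u) * s))"
        unfolding F_def by (rule sum.inter_restrict[symmetric]) simp
      also have "\<dots> = (\<Sum>n\<in>{N..<L}. \<Sum>u\<in>{u \<in> F. length u = n}. real m powr (- real (length u) * s))"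
        using L finF by (intro sum.group[symmetric]) (auto simp: F_def W_def)
      also have "\<dots> \<le> (\<Sum>n\<in>{N..<L}. b ^ n)"
      proof (rule sum_mono)
        fix n
        have "(\<Sum>u\<in>{u \<in> F. length u = n}. real m powr (- real (length u) * s)) =
          (\<Sum>u\<in>{u \<in> F. length u = n}. real m powr (- real n * s))"
          by (rule sum.cong) auto
        also have "\<dots> \<le> (\<Sum>u\<in>Pref_k m A n \<inter> W. real m powr (- real n * s))"
          by (rule sum_mono2) (auto simp: F_def W_def Pref_iff)
        finally have "(\<Sum>u\<in>{u \<in> F. length u = n}. real m powr (- real (length u) * s)) \<le>
          (\<Sum>u\<in>Pref_k m A n \<inter> W. real m powr (- real n * s))" .
        then show "(\<Sum>u\<in>{u \<in> F. length u = n}. real m powr (- real (length u) * s)) \<le> b ^ n"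
          using level[of n] by linarith
      qed
      also have "\<dots> \<le> b ^ N * (1 / (1 - b))"
      proof (cases "N < L")
        case True
        then have "(\<Sum>n\<in>{N..<L}. b ^ n) * (1 - b) = b ^ N - b ^ L"
          by (induction rule: strict_inc_induct[of N L]) (auto simp: algebra_simps sum.atLeast_Suc_lessThan)
        moreover have "b ^ L > 0" using b by simp
        ultimately have "(\<Sum>n\<in>{N..<L}. b ^ n) * (1 - b) \<le> b ^ N" by linarith
        then show ?thesis using b by (simp add: pos_le_divide_eq)
      qed (use b in auto)
      also have "\<dots> < e" using N2 by (simp add: N_def)
      finally have "(\<Sum>i<M. sdiam m (U i) powr s) \<le> e" by simp
      then show ?thesis by (simp add: sum_ennreal ennreal_leI)
    qed
    have "hausdorff_delta m s d A \<le> (\<Sum>i. ennreal (sdiam m (U i) powr s))"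
      unfolding hausdorff_delta_def using 1 2 by (intro INF_lower) auto
    also have "\<dots> \<le> ennreal e"
      unfolding suminf_eq_SUP by (rule SUP_least) (rule part)
    finally show ?thesis .
  qed
  then have "hausdorff_delta m s d A = 0" if "d > 0" for d
    using that by (metis ennreal_le_epsilon add_0 le_zero_eq)
  then show ?thesis by (simp add: hausdorff_measure_def)
qed

section \<open>Tools for showing that the Hausdorff measure is nonzero\<close>

lemma pre_in_Pref_k: "A \<subseteq> sigma m \<Longrightarrow> x \<in> A \<Longrightarrow> pre x n \<in> Pref_k m A n"
  by (simp add: Pref_k_eq_image)

text \<open>If \<open>G < p\<close> at a word, then the same holds at some child, since otherwise
  summing over the children would give \<open>p u <= G u\<close>. The resulting infinite branch is a
  point of \<open>A\<close> because \<open>A\<close> is closed. Values in \<open>ennreal\<close> let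
  \<open>G\<close> be an infinite sum.\<close>

lemma exists_path:
  fixes p G :: "nat list \<Rightarrow> ennreal"
  assumes m: "m \<ge> 2" and A: "closed_in_sigma m A" "A \<noteq> {}"
    and p: "\<And>u. u \<in> Pref m A \<Longrightarrow> p u \<le> (\<Sum>a\<in>children m A u. p (u @ [a]))"
    and G: "\<And>u. u \<in> Pref m A \<Longrightarrow> (\<Sum>a\<in>children m A u. G (u @ [a])) \<le> G u"
    and start: "G [] < p []"
  shows "\<exists>x\<in>A. \<forall>n. G (pre x n) < p (pre x n)"
proof -
  have "\<exists>f. \<forall>n. (f n \<in> Pref_k m A n \<and> G (f n) < p (f n)) \<and> (\<exists>a. f (Suc n) = f n @ [a])"
  proof (rule dependent_nat_choice)
    show "\<exists>u. u \<in> Pref_k m A 0 \<and> G u < p u"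
      using start A(2) by (auto simp: Pref_k_0)
  next
    fix u n assume u: "u \<in> Pref_k m A n \<and> G u < p u"
    then have "u \<in> Pref m A" by (auto dest: Pref_kD)
    have "\<exists>a\<in>children m A u. G (u @ [a]) < p (u @ [a])"
    proof (rule ccontr)
      assume "\<not> ?thesis"
      then have "(\<Sum>a\<in>children m A u. p (u @ [a])) \<le> (\<Sum>a\<in>children m A u. G (u @ [a]))"
        by (intro sum_mono) (auto simp: not_less)
      with p[OF \<open>u \<in> Pref m A\<close>] G[OF \<open>u \<in> Pref m A\<close>] have "p u \<le> G u"
        by (meson order_trans)
      with u show False by (meson leD)
    qed
    then obtain a where "a \<in> children m A u" "G (u @ [a]) < p (u @ [a])" by blast
    then show "\<exists>v. (v \<in> Pref_k m A (Suc n) \<and> G v < p v) \<and> (\<exists>a. v = u @ [a])"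
      using u by (intro exI[of _ "u @ [a]"]) (auto simp: snoc_Pref_k_iff)
  qed
  then obtain f where f: "\<And>n. f n \<in> Pref_k m A n" "\<And>n. G (f n) < p (f n)"
      "\<And>n. \<exists>a. f (Suc n) = f n @ [a]" by blast
  define x where "x n = last (f (Suc n))" for n
  have pre: "pre x n = f n" for n
  proof (induction n)
    case 0
    then show ?case using f(1)[of 0] by (simp add: Pref_k_def)
  next
    case (Suc n)
    then show ?case using f(3)[of n] by (auto simp: pre_Suc x_def)
  qed
  have "x \<in> A" by (rule mem_closed_if_prefixes[OF m A(1)]) (simp add: pre f)
  then show ?thesis using f(2) by (intro bexI[of _ x]) (simp_all add: pre)
qed

text \<open>A word \<open>v\<close> extends at most one child of \<open>u\<close>, and then it also
  extends \<open>u\<close>. Hence a cost attached to \<open>v\<close> is not counted more often at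
  the children than at \<open>u\<close>.\<close>

lemma sum_children_extension_le:
  fixes c :: ennreal
  assumes "finite C"
  shows "(\<Sum>a\<in>C. if take (Suc (length u)) v = u @ [a] then c else 0) \<le>
    (if take (length u) v = u then c else 0)"
proof (cases "\<exists>a. take (Suc (length u)) v = u @ [a]")
  case True
  then obtain a0 where a0: "take (Suc (length u)) v = u @ [a0]" by blast
  then have "take (length u) (take (Suc (length u)) v) = u" by simp
  then have "take (length u) v = u" by (simp add: min_def)
  then show ?thesis using a0 assms by (simp add: sum.delta)
next
  case False
  then show ?thesis by simp
qed

text \<open>Rounding \<open>- log m (sdiam m U)\<close> up to an integer gives the length of a
  cylinder that contains \<open>U\<close> and costs no more. The slack \<open>e\<close> pays for
  sets of diameter 0, since every word has positive cost.\<close>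

lemma exists_cylinder_superset:
  assumes m: "m \<ge> 2" and s: "s > 0" and U: "sdiam m U \<le> real m powr (- real N)" and e: "e > 0"
  obtains w where "length w \<ge> N" "\<And>x. x \<in> U \<Longrightarrow> pre x (length w) = w"
    "real m powr (- real (length w) * s) \<le> sdiam m U powr s + e"
proof -
  have "\<exists>n\<ge>N. sdiam m U < real m powr (1 - real n) \<and> real m powr (- real n * s) \<le> sdiam m U powr s + e"
  proof (cases "sdiam m U = 0")
    case True
    have "(\<lambda>n. real m powr (- real n * s)) \<longlonglongrightarrow> 0"
      using m s by real_asymp
    then have "eventually (\<lambda>n. real m powr (- real n * s) < e) sequentially"
      using e by (intro order_tendstoD) auto
    then obtain N' where N': "\<And>n. n \<ge> N' \<Longrightarrow> real m powr (- real n * s) < e"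
      by (auto simp: eventually_sequentially)
    show ?thesis
      using True m N'[of "max N N'"] by (intro exI[of _ "max N N'"]) auto
  next
    case False
    then have pos: "sdiam m U > 0" using sdiam_nonneg[OF m, of U] by simp
    define y where "y = - log (real m) (sdiam m U)"
    define n where "n = nat \<lceil>y\<rceil>"
    have sd: "sdiam m U = real m powr (- y)" using pos m by (simp add: y_def)
    have yN: "y \<ge> real N" using U m by (simp add: sd)
    have n: "y \<le> real n" "real n < y + 1" using yN by (auto simp: n_def) linarith+
    have "real m powr (- real n * s) \<le> real m powr (- y * s)"
      using n(1) m s by (intro powr_mono) auto
    also have "\<dots> = sdiam m U powr s" by (simp add: sd powr_powr)
    finally have "real m powr (- real n * s) \<le> sdiam m U powr s + e" using e by simp
    moreover have "sdiam m U < real m powr (1 - real n)" using n m by (simp add: sd)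
    moreover have "N \<le> n" using n yN by linarith
    ultimately show ?thesis by blast
  qed
  then obtain n where n: "n \<ge> N" "sdiam m U < real m powr (1 - real n)"
    "real m powr (- real n * s) \<le> sdiam m U powr s + e" by blast
  \<comment> \<open>If \<open>U\<close> is empty, \<open>z\<close> is arbitrary and the claim on
    prefixes is vacuous; only the length of \<open>pre z n\<close> matters then.\<close>
  define z where "z = (SOME x. x \<in> U)"
  have "pre x n = pre z n" if "x \<in> U" for x
  proof -
    have "z \<in> U" unfolding z_def using that by (rule someI[of "\<lambda>x. x \<in> U"])
    then have "rho m x z < real m powr (1 - real n)"
      using rho_le_sdiam[OF m that] n(2) by (meson le_less_trans)
    then show ?thesis by (simp add: pre_eq_iff rho_less_imp_agree[OF m])
  qed
  then show ?thesis using n that[of "pre z n"] by simp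
qed

text \<open>A mass distribution principle in which the words carrying too much mass are only required to
  have summable total mass. It needs no measure: if \<open>G u\<close> is the cost of covering the cylinder of
  \<open>u\<close> plus the mass of the bad words below \<open>u\<close>, then a cheap cover leaves a path along which the
  mass stays above \<open>G\<close>, and the limit of this path is an uncovered point.\<close>

lemma hausdorff_measure_pos:
  fixes p :: "nat list \<Rightarrow> real"
  assumes m: "m \<ge> 2" and A: "closed_in_sigma m A" "A \<noteq> {}" and s: "s > 0"
    and p0: "\<And>u. u \<in> Pref m A \<Longrightarrow> p u \<ge> 0" and p1: "p [] = 1"
    and padd: "\<And>u. u \<in> Pref m A \<Longrightarrow> p u \<le> (\<Sum>a\<in>children m A u. p (u @ [a]))"
    and bad: "summable (\<lambda>n. \<Sum>u\<in>{u \<in> Pref_k m A n. p u > real m powr (- real n * s)}. p u)"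
  shows "hausdorff_measure m s A \<noteq> 0"
proof -
  define B where "B n = {u \<in> Pref_k m A n. p u > real m powr (- real n * s)}" for n
  define b where "b n = (\<Sum>u\<in>B n. p u)" for n
  have finB: "finite (B n)" for n by (simp add: B_def)
  have Bp: "p u \<ge> 0" if "u \<in> B n" for u n using that p0 by (auto simp: B_def dest: Pref_kD)
  have b0: "b n \<ge> 0" for n unfolding b_def by (intro sum_nonneg Bp)
  have sb: "summable b" using bad by (simp add: b_def[abs_def] B_def)
  \<comment> \<open>The budget of \<open>p [] = 1\<close>: bad words of length at least
    \<open>N\<close> take less than 1/2, the cover less than 1/4, and the slacks
    \<open>(1 / 2) ^ Suc i * (1 / 4)\<close> of the enclosing cylinders 1/4 in total.\<close>
  then obtain N where N: "norm (\<Sum>n. b (n + N)) < 1 / 2"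
    using suminf_exist_split[of "1/2" b] by auto
  have sbN: "summable (\<lambda>n. b (n + N))" using sb by (simp add: summable_iff_shift)
  define d where "d = real m powr (- real N)"
  have "ennreal (1 / 4) \<le> hausdorff_delta m s d A"
    unfolding hausdorff_delta_def
  proof (rule INF_greatest, rule ccontr)
    fix U :: "nat \<Rightarrow> (nat \<Rightarrow> nat) set"
    assume "U \<in> {U. (\<forall>i. U i \<subseteq> sigma m \<and> sdiam m (U i) \<le> d) \<and> A \<subseteq> (\<Union>i. U i)}"
    then have U: "\<And>i. sdiam m (U i) \<le> d" "A \<subseteq> (\<Union>i. U i)" by auto
    assume "\<not> ennreal (1 / 4) \<le> (\<Sum>i. ennreal (sdiam m (U i) powr s))"
    then have small: "(\<Sum>i. ennreal (sdiam m (U i) powr s)) < ennreal (1 / 4)" by simp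
    have "\<exists>w. length w \<ge> N \<and> (\<forall>x. x \<in> U i \<longrightarrow> pre x (length w) = w) \<and>
        real m powr (- real (length w) * s) \<le> sdiam m (U i) powr s + (1 / 2) ^ Suc i * (1 / 4)" for i
      using exists_cylinder_superset[OF m s, of "U i" N "(1 / 2) ^ Suc i * (1 / 4)"] U(1)[of i]
      by (auto simp: d_def)
    then obtain w where w: "\<And>i. length (w i) \<ge> N" "\<And>i x. x \<in> U i \<Longrightarrow> pre x (length (w i)) = w i"
      "\<And>i. real m powr (- real (length (w i)) * s) \<le> sdiam m (U i) powr s + (1 / 2) ^ Suc i * (1 / 4)"
      by metis
    define c where "c i = ennreal (real m powr (- real (length (w i)) * s))" for i
    \<comment> \<open>The test \<open>take (length u) v = u\<close> says that \<open>v\<close>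
      extends \<open>u\<close>; at the root it holds for every word.\<close>
    define G where "G u = (\<Sum>i. if take (length u) (w i) = u then c i else 0) +
      (\<Sum>n. \<Sum>v\<in>B (n + N). if take (length u) v = u then ennreal (p v) else 0)" for u
    have "c i \<le> ennreal (sdiam m (U i) powr s) + ennreal ((1 / 2) ^ Suc i * (1 / 4))" for i
      unfolding c_def using ennreal_leI[OF w(3)[of i]] by (subst (asm) ennreal_plus) auto
    then have "(\<Sum>i. c i) \<le> (\<Sum>i. ennreal (sdiam m (U i) powr s) + ennreal ((1 / 2) ^ Suc i * (1 / 4)))"
      by (intro suminf_le summableI)
    also have "\<dots> = (\<Sum>i. ennreal (sdiam m (U i) powr s)) + (\<Sum>i. ennreal ((1 / 2) ^ Suc i * (1 / 4)))"
      by (intro suminf_add[symmetric] summableI)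
    also have "(\<Sum>i. ennreal ((1 / 2) ^ Suc i * (1 / 4))) = ennreal (1 / 4)"
      using sums_mult2[OF power_half_series, of "1/4"]
      by (intro suminf_ennreal_eq) auto
    finally have "(\<Sum>i. c i) \<le> (\<Sum>i. ennreal (sdiam m (U i) powr s)) + ennreal (1 / 4)" .
    also have "\<dots> < ennreal (1 / 4) + ennreal (1 / 4)"
      using small by (simp add: ennreal_add_left_cancel_less add.commute)
    finally have c_less: "(\<Sum>i. c i) < ennreal (1 / 2)"
      by (simp add: ennreal_plus[symmetric] del: ennreal_plus)
    have "(\<Sum>n. \<Sum>v\<in>B (n + N). ennreal (p v)) = (\<Sum>n. ennreal (b (n + N)))"
      unfolding b_def using Bp by (intro suminf_cong sum_ennreal)
    also have "\<dots> = ennreal (\<Sum>n. b (n + N))"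
      by (rule suminf_ennreal2[OF b0 sbN])
    also have "\<dots> < ennreal (1 / 2)" using N by (intro ennreal_lessI) auto
    finally have "G [] < ennreal (1 / 2) + ennreal (1 / 2)"
      unfolding G_def using c_less by (simp add: add_strict_mono)
    also have "\<dots> = ennreal (p [])" by (subst ennreal_plus[symmetric]) (simp_all add: p1)
    finally have start: "G [] < ennreal (p [])" .
    have Gadd: "(\<Sum>a\<in>children m A u. G (u @ [a])) \<le> G u" for u
    proof -
      have "(\<Sum>a\<in>children m A u. G (u @ [a])) =
        (\<Sum>i. \<Sum>a\<in>children m A u. if take (Suc (length u)) (w i) = u @ [a] then c i else 0) +
        (\<Sum>n. \<Sum>v\<in>B (n + N). \<Sum>a\<in>children m A u. if take (Suc (length u)) v = u @ [a] then ennreal (p v) else 0)"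
        unfolding G_def
        by (simp add: sum.distrib suminf_sum[OF summableI, symmetric] sum.swap[of _ "B _"])
      also have "\<dots> \<le> G u"
        unfolding G_def
        by (intro add_mono suminf_le summableI sum_mono sum_children_extension_le finite_children)
      finally show ?thesis .
    qed
    have "\<exists>x\<in>A. \<forall>n. G (pre x n) < ennreal (p (pre x n))"
    proof (rule exists_path[OF m A, where p = "\<lambda>u. ennreal (p u)" and G = G])
      fix u assume u: "u \<in> Pref m A"
      have "ennreal (p u) \<le> ennreal (\<Sum>a\<in>children m A u. p (u @ [a]))"
        using padd[OF u] by (rule ennreal_leI)
      also have "\<dots> = (\<Sum>a\<in>children m A u. ennreal (p (u @ [a])))"
        by (rule sum_ennreal[symmetric]) (auto simp: children_def p0)
      finally show "ennreal (p u) \<le> (\<Sum>a\<in>children m A u. ennreal (p (u @ [a])))" .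
    qed (rule Gadd start)+
    then obtain x where x: "x \<in> A" "\<And>n. G (pre x n) < ennreal (p (pre x n))" by blast
    then obtain i where i: "x \<in> U i" using U(2) by auto
    let ?u = "w i"
    have u: "pre x (length ?u) = ?u" by (rule w(2)[OF i])
    have uP: "?u \<in> Pref_k m A (length ?u)"
      using pre_in_Pref_k[OF _ x(1), of m "length ?u"] A(1) u by (simp add: closed_in_sigma_def)
    \<comment> \<open>The path reaches the covering word \<open>?u\<close>, where \<open>G\<close>
      is at least \<open>p\<close>: a word of small mass is paid for by its own cost in the first
      sum, a bad one occurs in the second sum because its length is at least
      \<open>N\<close>.\<close>
    have "ennreal (p ?u) \<le> G ?u"
    proof (cases "p ?u \<le> real m powr (- real (length ?u) * s)")
      case True
      then have "ennreal (p ?u) \<le> (if take (length ?u) (w i) = ?u then c i else 0)"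
        by (simp add: c_def ennreal_leI)
      also have "\<dots> \<le> (\<Sum>j. if take (length ?u) (w j) = ?u then c j else 0)"
        using sum_le_suminf[OF summableI, of "{i}" "\<lambda>j. if take (length ?u) (w j) = ?u then c j else 0"] by simp
      also have "\<dots> \<le> G ?u" by (simp add: G_def)
      finally show ?thesis .
    next
      case False
      define k where "k = length ?u - N"
      have k: "k + N = length ?u" using w(1)[of i] by (simp add: k_def)
      then have uB: "?u \<in> B (k + N)" using False uP by (simp add: B_def)
      let ?g = "\<lambda>n. \<Sum>v\<in>B (n + N). if take (length ?u) v = ?u then ennreal (p v) else 0"
      have "ennreal (p ?u) = (\<Sum>v\<in>{?u}. if take (length ?u) v = ?u then ennreal (p v) else 0)" by simp
      also have "\<dots> \<le> ?g k" using uB finB by (intro sum_mono2) auto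
      also have "\<dots> \<le> (\<Sum>n. ?g n)" using sum_le_suminf[OF summableI, of "{k}" ?g] by simp
      also have "\<dots> \<le> G ?u" by (simp add: G_def)
      finally show ?thesis .
    qed
    with x(2)[of "length ?u"] show False by (simp add: u)
  qed
  also have "\<dots> \<le> hausdorff_measure m s A"
    unfolding hausdorff_measure_def using m by (intro SUP_upper) (auto simp: d_def)
  finally show ?thesis by (auto simp: le_zero_eq)
qed

section \<open>Decomposition of the positive integers into geometric chains\<close>

text \<open>The start of the chain through \<open>j\<close>; the multiplicity of \<open>q\<close> in
  \<open>j\<close> is the position of \<open>j\<close> in that chain, counted from 0.\<close>

definition core :: "nat \<Rightarrow> nat \<Rightarrow> nat" where
  "core q j = j div q ^ multiplicity q j"

definition roots :: "nat \<Rightarrow> nat \<Rightarrow> nat set" where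
  "roots q n = {i \<in> {1..n}. \<not> q dvd i}"

text \<open>The first index that leaves \<open>1, ..., n\<close> is also the number of members of
  the chain of \<open>i\<close> that stay inside.\<close>

definition chain_len :: "nat \<Rightarrow> nat \<Rightarrow> nat \<Rightarrow> nat" where
  "chain_len q n i = (LEAST l. n < i * q ^ l)"

lemma finite_roots [simp]: "finite (roots q n)"
  by (simp add: roots_def)

lemma multiplicity_mult_power:
  fixes q i :: nat
  assumes "q \<ge> 2" "\<not> q dvd i"
  shows "multiplicity q (i * q ^ l) = l"
proof (induction l)
  case 0
  then show ?case using assms by (simp add: not_dvd_imp_multiplicity_0)
next
  case (Suc l)
  have "i \<noteq> 0" using assms by (intro notI) simp
  then have "multiplicity q (q * (i * q ^ l)) = Suc (multiplicity q (i * q ^ l))"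
    using assms by (intro multiplicity_times_same) auto
  then show ?case using Suc by (simp add: mult.left_commute)
qed

lemma core_mult_power:
  assumes "q \<ge> 2" "\<not> q dvd i"
  shows "core q (i * q ^ l) = i"
  using assms by (simp add: core_def multiplicity_mult_power)

lemma core_power_multiplicity: "core q j * q ^ multiplicity q j = j"
  by (simp add: core_def multiplicity_dvd)

lemma not_dvd_core: "q \<ge> 2 \<Longrightarrow> j \<ge> 1 \<Longrightarrow> \<not> q dvd core q j"
  unfolding core_def by (rule multiplicity_decompose) auto

lemma core_pos: "j \<ge> 1 \<Longrightarrow> core q j \<ge> 1"
  using core_power_multiplicity[of q j] by (cases "core q j") auto

lemma less_chain_len_iff:
  assumes "q \<ge> 2" "i \<ge> 1"
  shows "l < chain_len q n i \<longleftrightarrow> i * q ^ l \<le> n"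
proof
  assume "l < chain_len q n i"
  then show "i * q ^ l \<le> n" unfolding chain_len_def by (auto dest: not_less_Least)
next
  assume *: "i * q ^ l \<le> n"
  \<comment> \<open>This shows that some index leaves the range, so that the \<open>LEAST\<close> in
    \<open>chain_len\<close> is attained.\<close>
  have "n < 2 ^ n" by (rule less_exp)
  also have "2 ^ n \<le> q ^ n" using assms by (simp add: power_mono)
  also have "\<dots> \<le> i * q ^ n" using assms by simp
  finally have "n < i * q ^ chain_len q n i"
    unfolding chain_len_def by (rule LeastI)
  with * have "i * q ^ l < i * q ^ chain_len q n i" by (rule le_less_trans)
  then have "q ^ l < q ^ chain_len q n i" by simp
  then show "l < chain_len q n i" using assms by (simp add: power_strict_increasing_iff)
qed

text \<open>The inverse sends \<open>j\<close> to its core and multiplicity. This is the change of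
  variables that regroups sums and products over positions by chains.\<close>

lemma bij_betw_chains:
  assumes q: "q \<ge> 2"
  shows "bij_betw (\<lambda>(i, l). i * q ^ l) (SIGMA i:roots q n. {..<chain_len q n i}) {1..n}"
proof (rule bij_betw_byWitness[where f' = "\<lambda>j. (core q j, multiplicity q j)"])
  show "\<forall>a\<in>SIGMA i:roots q n. {..<chain_len q n i}.
      (core q (case a of (i, l) \<Rightarrow> i * q ^ l), multiplicity q (case a of (i, l) \<Rightarrow> i * q ^ l)) = a"
    using q by (auto simp: roots_def core_mult_power multiplicity_mult_power)
  show "\<forall>a'\<in>{1..n}. (case (core q a', multiplicity q a') of (i, l) \<Rightarrow> i * q ^ l) = a'"
    by (auto simp: core_power_multiplicity)
  show "(\<lambda>(i, l). i * q ^ l) ` (SIGMA i:roots q n. {..<chain_len q n i}) \<subseteq> {1..n}"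
    using q by (auto simp: roots_def less_chain_len_iff)
  show "(\<lambda>j. (core q j, multiplicity q j)) ` {1..n} \<subseteq> (SIGMA i:roots q n. {..<chain_len q n i})"
  proof (clarsimp)
    fix j assume j: "Suc 0 \<le> j" "j \<le> n"
    have "core q j \<le> j" unfolding core_def by (rule div_le_dividend)
    then show "core q j \<in> roots q n \<and> multiplicity q j < chain_len q n (core q j)"
      using j q not_dvd_core[of q j] core_pos[of j q]
      by (simp add: roots_def less_chain_len_iff core_power_multiplicity)
  qed
qed

lemma sum_chains:
  assumes "q \<ge> 2"
  shows "(\<Sum>j\<in>{1..n}. h j) = (\<Sum>i\<in>roots q n. \<Sum>l<chain_len q n i. h (i * q ^ l))"
  using sum.reindex_bij_betw[OF bij_betw_chains[OF assms], of h n] by (simp add: sum.Sigma split_def)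

lemma prod_chains:
  assumes "q \<ge> 2"
  shows "(\<Prod>j\<in>{1..n}. h j) = (\<Prod>i\<in>roots q n. \<Prod>l<chain_len q n i. h (i * q ^ l))"
  using prod.reindex_bij_betw[OF bij_betw_chains[OF assms], of h n] by (simp add: prod.Sigma split_def)

text \<open>The source of all recursions from \<open>n\<close> to \<open>n div q\<close>: the
  multiples of \<open>q\<close> up to \<open>n\<close> are a scaled copy of
  \<open>1, ..., n div q\<close>.\<close>

lemma sum_split_multiples:
  assumes q: "q \<ge> 2"
  shows "(\<Sum>j\<in>{1..n}. h j) = (\<Sum>j\<in>roots q n. h j) + (\<Sum>j\<in>{1..n div q}. h (q * j))"
proof -
  have "{1..n} = roots q n \<union> (*) q ` {1..n div q}"
  proof (intro equalityI subsetI)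
    fix j assume "j \<in> {1..n}"
    moreover have "j = q * (j div q)" "1 \<le> j div q" "j div q \<le> n div q" if "q dvd j"
      using that q calculation by (auto simp: div_le_mono Suc_le_eq elim!: dvdE)
    ultimately show "j \<in> roots q n \<union> (*) q ` {1..n div q}"
      by (cases "q dvd j") (auto simp: roots_def)
  next
    fix j assume "j \<in> roots q n \<union> (*) q ` {1..n div q}"
    then show "j \<in> {1..n}"
    proof
      assume "j \<in> (*) q ` {1..n div q}"
      then obtain i where "j = q * i" "i \<in> {1..n div q}" by (rule imageE)
      then have i: "j = q * i" "1 \<le> i" "i \<le> n div q" by auto
      then have "i * q \<le> n" using q by (simp add: less_eq_div_iff_mult_less_eq)
      then show ?thesis using i q by (simp add: mult.commute)
    qed (auto simp: roots_def)
  qed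
  then have "(\<Sum>j\<in>{1..n}. h j) = (\<Sum>j\<in>roots q n \<union> (*) q ` {1..n div q}. h j)" by simp
  also have "\<dots> = (\<Sum>j\<in>roots q n. h j) + (\<Sum>j\<in>(*) q ` {1..n div q}. h j)"
    by (rule sum.union_disjoint) (auto simp: roots_def)
  also have "(\<Sum>j\<in>(*) q ` {1..n div q}. h j) = (\<Sum>j\<in>{1..n div q}. h (q * j))"
    using q by (subst sum.reindex) (auto simp: inj_on_def)
  finally show ?thesis .
qed

section \<open>Averages over positions and over chains\<close>

lemma card_roots: "q \<ge> 2 \<Longrightarrow> real (card (roots q n)) = real n - real (n div q)"
  using sum_split_multiples[of q "\<lambda>_. 1::real" n] by simp

text \<open>The weights \<open>(q - 1) / q ^ Suc l\<close> sum to 1, so the expression is a weighted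
  mean of \<open>f\<close> and inherits its bound.\<close>

lemma bounded_average:
  fixes f :: "nat \<Rightarrow> real"
  assumes q: "q \<ge> 2" and f: "\<And>l. \<bar>f l\<bar> \<le> B"
  shows "summable (\<lambda>l. f l / real q ^ Suc l)"
    and "\<bar>(real q - 1) * (\<Sum>l. f l / real q ^ Suc l)\<bar> \<le> B"
proof -
  have geo: "(\<lambda>l. B / real q ^ Suc l) sums (B / (real q - 1))"
  proof -
    have "(\<lambda>l. (1 / real q) ^ l) sums (1 / (1 - 1 / real q))"
      using q by (intro geometric_sums) auto
    from sums_mult[OF this, of "B / real q"] show ?thesis
      using q by (simp add: field_simps power_divide)
  qed
  have bd: "norm (f l / real q ^ Suc l) \<le> B / real q ^ Suc l" for l
    using f[of l] by (simp add: divide_right_mono)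
  show s: "summable (\<lambda>l. f l / real q ^ Suc l)"
    by (rule summable_comparison_test'[OF sums_summable[OF geo] bd])
  have sn: "summable (\<lambda>l. norm (f l / real q ^ Suc l))"
    by (rule summable_comparison_test'[OF sums_summable[OF geo]]) (use bd in simp)
  have "norm (\<Sum>l. f l / real q ^ Suc l) \<le> (\<Sum>l. B / real q ^ Suc l)"
    using summable_norm[OF sn] suminf_le[OF bd sn sums_summable[OF geo]] by linarith
  also have "\<dots> = B / (real q - 1)" using geo by (rule sums_unique[symmetric])
  finally show "\<bar>(real q - 1) * (\<Sum>l. f l / real q ^ Suc l)\<bar> \<le> B"
    using q by (simp add: abs_mult pos_le_divide_eq mult.commute del: power_Suc)
qed

text \<open>Splitting off the \<open>j\<close> that are not divisible by \<open>q\<close> reduces \<open>(n, f)\<close> to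
  \<open>(n div q, f \<circ> Suc)\<close>, each time with a bounded error.\<close>

lemma sum_multiplicity_error:
  fixes f :: "nat \<Rightarrow> real"
  assumes q: "q \<ge> 2" and f: "\<And>l. \<bar>f l\<bar> \<le> B" and n: "n < q ^ d"
  shows "\<bar>(\<Sum>j\<in>{1..n}. f (multiplicity q j)) - real n * ((real q - 1) * (\<Sum>l. f l / real q ^ Suc l))\<bar> \<le> 2 * B * real d"
  using f n
proof (induction d arbitrary: n f)
  case 0
  then show ?case by simp
next
  case (Suc d)
  let ?L = "\<lambda>f. (real q - 1) * (\<Sum>l. f l / real q ^ Suc l)"
  let ?T = "\<lambda>f n. \<Sum>j\<in>{1..n}. f (multiplicity q j)"
  let ?f = "\<lambda>l. f (Suc l)"
  have T: "?T f n = f 0 * (real n - real (n div q)) + ?T ?f (n div q)"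
  proof -
    have "(\<Sum>j\<in>roots q n. f (multiplicity q j)) = (\<Sum>j\<in>roots q n. f 0)"
      by (rule sum.cong) (auto simp: roots_def not_dvd_imp_multiplicity_0)
    moreover have "(\<Sum>j\<in>{1..n div q}. f (multiplicity q (q * j))) = ?T ?f (n div q)"
      using q by (intro sum.cong) (auto simp: multiplicity_times_same)
    ultimately show ?thesis
      using q sum_split_multiples[of q "\<lambda>j. f (multiplicity q j)" n] by (simp add: card_roots)
  qed
  have L: "?L f = f 0 * (1 - 1 / real q) + ?L ?f / real q"
  proof -
    have "(\<Sum>l. f l / real q ^ Suc l) = f 0 / real q + (\<Sum>l. f (Suc l) / real q ^ Suc (Suc l))"
      using suminf_split_head[OF bounded_average(1)[where f = f, OF q Suc.prems(1)]] by simp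
    also have "(\<Sum>l. f (Suc l) / real q ^ Suc (Suc l)) = (\<Sum>l. f (Suc l) / real q ^ Suc l / real q)"
      by (simp add: field_simps)
    also have "\<dots> = (\<Sum>l. f (Suc l) / real q ^ Suc l) / real q"
      by (rule suminf_divide) (rule bounded_average(1)[OF q Suc.prems(1)])
    finally show ?thesis using q by (simp add: field_simps)
  qed
  define X where "X = ?L ?f"
  \<comment> \<open>The rounding error of \<open>n div q\<close> is the only error of one step. It
    is multiplied by \<open>f 0\<close> and by the mean of the shifted function, both bounded by
    \<open>B\<close>.\<close>
  define \<delta> where "\<delta> = real n / real q - real (n div q)"
  have \<delta>: "0 \<le> \<delta>" "\<delta> \<le> 1"
  proof -
    have "real n = real q * real (n div q) + real (n mod q)"
      by (metis mult_div_mod_eq of_nat_add of_nat_mult)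
    then have "\<delta> = real (n mod q) / real q" using q by (simp add: \<delta>_def field_simps)
    moreover have "n mod q < q" using q by simp
    ultimately show "0 \<le> \<delta>" "\<delta> \<le> 1" by auto
  qed
  have fb: "\<bar>f 0\<bar> \<le> B" by (rule Suc.prems)
  have Lb: "\<bar>?L ?f\<bar> \<le> B" by (rule bounded_average(2)[OF q]) (rule Suc.prems)
  have "n div q < q ^ d" using Suc.prems(2) q by (simp add: div_less_iff_less_mult mult.commute)
  then have IH: "\<bar>?T ?f (n div q) - real (n div q) * ?L ?f\<bar> \<le> 2 * B * real d"
    using Suc.IH[of ?f "n div q"] Suc.prems(1) by blast
  have "?T f n - real n * ?L f = f 0 * \<delta> - \<delta> * ?L ?f + (?T ?f (n div q) - real (n div q) * ?L ?f)"
    unfolding T L \<delta>_def X_def[symmetric] by (simp add: algebra_simps)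
  moreover have "\<bar>f 0 * \<delta>\<bar> \<le> B" "\<bar>\<delta> * ?L ?f\<bar> \<le> B"
    using mult_mono[OF fb, of \<delta> 1] mult_mono[OF Lb, of \<delta> 1] \<delta> fb by (auto simp: abs_mult mult.commute)
  ultimately have "\<bar>?T f n - real n * ?L f\<bar> \<le> B + B + 2 * B * real d"
    using IH by linarith
  then show ?case by (simp add: algebra_simps)
qed

text \<open>The error in \<open>sum_multiplicity_error\<close> is proportional to the number of base
  \<open>q\<close> digits of \<open>n\<close>, hence logarithmic in \<open>n\<close>.\<close>

lemma average_multiplicity:
  fixes f :: "nat \<Rightarrow> real"
  assumes q: "q \<ge> 2" and f: "\<And>l. \<bar>f l\<bar> \<le> B"
  shows "(\<lambda>n. (\<Sum>j\<in>{1..n}. f (multiplicity q j)) / real n) \<longlonglongrightarrow> (real q - 1) * (\<Sum>l. f l / real q ^ Suc l)"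
    (is "(\<lambda>n. ?T n / real n) \<longlonglongrightarrow> ?L")
proof -
  have B: "B \<ge> 0" using f[of 0] by linarith
  have "norm (?T n / real n - ?L) \<le> 2 * B * (log 2 (real n) + 1) / real n" if n: "n \<ge> 1" for n
  proof -
    obtain d where d: "q ^ d \<le> n" "n < q ^ (d + 1)" using ex_power_ivl1[OF q n] by auto
    have "2 ^ d \<le> q ^ d" using q by (simp add: power_mono)
    with d have "2 ^ d \<le> n" by linarith
    then have "(2::real) ^ d \<le> real n" by (metis of_nat_le_iff of_nat_numeral of_nat_power)
    then have "real d \<le> log 2 (real n)" using n by (simp add: le_log_iff powr_realpow)
    then have "2 * B * real (d + 1) \<le> 2 * B * (log 2 (real n) + 1)" using B by (intro mult_left_mono) auto
    then have "\<bar>?T n - real n * ?L\<bar> \<le> 2 * B * (log 2 (real n) + 1)"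
      using sum_multiplicity_error[where f = f, OF q f d(2)] by linarith
    moreover have "?T n / real n - ?L = (?T n - real n * ?L) / real n" using n by (simp add: field_simps)
    ultimately show ?thesis using n by (simp add: divide_right_mono)
  qed
  then have "eventually (\<lambda>n. norm (?T n / real n - ?L) \<le> 2 * B * (log 2 (real n) + 1) / real n) sequentially"
    by (auto simp: eventually_sequentially)
  moreover have "(\<lambda>n. 2 * B * (log 2 (real n) + 1) / real n) \<longlonglongrightarrow> 0" by real_asymp
  ultimately have "(\<lambda>n. ?T n / real n - ?L) \<longlonglongrightarrow> 0" by (rule Lim_null_comparison)
  then show ?thesis by (rule LIM_zero_cancel)
qed

text \<open>The square accommodates the quadratic remainder in \<open>ln_Z_le\<close>; it also
  dominates linear growth.\<close>

lemma summable_square_div_power: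
  fixes q :: nat
  assumes "q \<ge> 2"
  shows "summable (\<lambda>k. real (Suc k) ^ 2 / real q ^ (k + 2))"
proof (rule summable_comparison_test')
  show "summable (\<lambda>k. real (Suc k) ^ 2 / 2 ^ (k + 2))"
  proof (rule summable_comparison_test_bigo)
    show "summable (\<lambda>k. norm (inverse (real k ^ 2)))" using inverse_power_summable[of 2, where 'a = real] by simp
    show "(\<lambda>k. real (Suc k) ^ 2 / 2 ^ (k + 2)) \<in> O(\<lambda>k. inverse (real k ^ 2))" by real_asymp
  qed
  fix k
  have "(2::real) ^ (k + 2) \<le> real q ^ (k + 2)" using assms by (intro power_mono) auto
  then show "norm (real (Suc k) ^ 2 / real q ^ (k + 2)) \<le> real (Suc k) ^ 2 / 2 ^ (k + 2)"
    by (simp add: frac_le)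
qed

lemma linear_growth:
  fixes g :: "nat \<Rightarrow> real"
  assumes "g 0 = 0" "\<And>k. \<bar>g (Suc k) - g k\<bar> \<le> B"
  shows "\<bar>g k\<bar> \<le> B * real k"
proof (induction k)
  case (Suc k)
  then show ?case using assms(2)[of k] by (simp add: algebra_simps)
qed (simp add: assms)

text \<open>Summation by parts: since \<open>g 0 = 0\<close>, the series of
  \<open>g k / q ^ Suc k\<close> is the given one with its index shifted, while that of
  \<open>g (Suc k) / q ^ Suc k\<close> is \<open>q\<close> times it.\<close>

lemma linear_growth_series:
  fixes g :: "nat \<Rightarrow> real"
  assumes q: "q \<ge> 2" and g: "g 0 = 0" "\<And>k. \<bar>g (Suc k) - g k\<bar> \<le> B"
  shows "summable (\<lambda>k. g (Suc k) / real q ^ (k + 2))"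
    and "(real q - 1) * (\<Sum>k. g (Suc k) / real q ^ (k + 2)) = (\<Sum>k. (g (Suc k) - g k) / real q ^ Suc k)"
proof -
  have B: "B \<ge> 0" using g(2)[of 0] by linarith
  show s: "summable (\<lambda>k. g (Suc k) / real q ^ (k + 2))"
  proof (rule summable_comparison_test'[OF summable_mult[OF summable_square_div_power[OF q], of B]])
    fix k
    have "\<bar>g (Suc k)\<bar> \<le> B * real (Suc k)" by (rule linear_growth[OF g])
    also have "\<dots> \<le> B * real (Suc k) ^ 2"
      using B by (intro mult_left_mono) (auto simp: power2_eq_square)
    finally show "norm (g (Suc k) / real q ^ (k + 2)) \<le> B * (real (Suc k) ^ 2 / real q ^ (k + 2))"
      by (simp add: divide_right_mono)
  qed
  have "(\<lambda>k. g (Suc k) / real q ^ Suc (Suc k)) sums (\<Sum>k. g (Suc k) / real q ^ (k + 2))"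
    using s by (simp add: summable_sums)
  from this[THEN sums_Suc] have "(\<lambda>k. g k / real q ^ Suc k) sums (\<Sum>k. g (Suc k) / real q ^ (k + 2))"
    by (simp add: g)
  moreover have "(\<lambda>k. g (Suc k) / real q ^ Suc k) sums (real q * (\<Sum>k. g (Suc k) / real q ^ (k + 2)))"
    using sums_mult[OF summable_sums[OF s], of "real q"] q by (simp add: field_simps)
  ultimately have "(\<lambda>k. g (Suc k) / real q ^ Suc k - g k / real q ^ Suc k) sums
      (real q * (\<Sum>k. g (Suc k) / real q ^ (k + 2)) - (\<Sum>k. g (Suc k) / real q ^ (k + 2)))"
    by (intro sums_diff)
  then have "(\<lambda>k. (g (Suc k) - g k) / real q ^ Suc k) sums ((real q - 1) * (\<Sum>k. g (Suc k) / real q ^ (k + 2)))"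
    by (simp add: diff_divide_distrib algebra_simps)
  then show "(real q - 1) * (\<Sum>k. g (Suc k) / real q ^ (k + 2)) = (\<Sum>k. (g (Suc k) - g k) / real q ^ Suc k)"
    by (rule sums_unique)
qed

text \<open>Telescoping \<open>g\<close> along each chain charges position \<open>j\<close> with an
  increment that depends only on its multiplicity, so \<open>average_multiplicity\<close> applies;
  summation by parts restores \<open>g\<close>.\<close>

lemma average_chain_len:
  fixes g :: "nat \<Rightarrow> real"
  assumes q: "q \<ge> 2" and g: "g 0 = 0" "\<And>k. \<bar>g (Suc k) - g k\<bar> \<le> B"
  shows "(\<lambda>n. (\<Sum>i\<in>roots q n. g (chain_len q n i)) / real n) \<longlonglongrightarrow>
    (real q - 1)^2 * (\<Sum>k. g (Suc k) / real q ^ (k + 2))"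
proof -
  let ?f = "\<lambda>k. g (Suc k) - g k"
  have "(\<Sum>j\<in>{1..n}. ?f (multiplicity q j)) = (\<Sum>i\<in>roots q n. g (chain_len q n i))" for n
  proof -
    have "(\<Sum>j\<in>{1..n}. ?f (multiplicity q j)) = (\<Sum>i\<in>roots q n. \<Sum>l<chain_len q n i. ?f (multiplicity q (i * q ^ l)))"
      by (rule sum_chains[OF q])
    also have "\<dots> = (\<Sum>i\<in>roots q n. \<Sum>l<chain_len q n i. ?f l)"
      using q by (intro sum.cong) (auto simp: roots_def multiplicity_mult_power)
    finally show ?thesis by (simp add: sum_lessThan_telescope g)
  qed
  moreover have "(\<lambda>n. (\<Sum>j\<in>{1..n}. ?f (multiplicity q j)) / real n) \<longlonglongrightarrow> (real q - 1) * (\<Sum>l. ?f l / real q ^ Suc l)"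
    by (rule average_multiplicity[OF q g(2)])
  ultimately show ?thesis
    using linear_growth_series(2)[where g = g, OF q g] by (simp only: power2_eq_square mult.assoc)
qed

section \<open>The optimal measure on the prefix tree and its entropy\<close>

locale prefix_weights =
  fixes m q :: nat and \<Omega> :: "(nat \<Rightarrow> nat) set" and t :: "nat list \<Rightarrow> real"
  assumes m: "m \<ge> 2" and q: "q \<ge> 2"
    and nonempty: "\<Omega> \<noteq> {}" and closed: "closed_in_sigma m \<Omega>"
    and t_ge_1: "u \<in> Pref m \<Omega> \<Longrightarrow> 1 \<le> t u"
    and t_le: "u \<in> Pref m \<Omega> \<Longrightarrow> t u \<le> real m powr (1 / (real q - 1))"
    and t_power: "u \<in> Pref m \<Omega> \<Longrightarrow> t u ^ q = (\<Sum>a\<in>children m \<Omega> u. t (u @ [a]))"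
begin

abbreviation "P \<equiv> Pref_k m \<Omega>"
abbreviation "C \<equiv> ln (real m) / (real q - 1)"

lemma \<Omega>_subset: "\<Omega> \<subseteq> sigma m"
  using closed by (simp add: closed_in_sigma_def)

lemma P_0: "P 0 = {[]}"
  by (rule Pref_k_0[OF nonempty])

lemma Nil_Pref: "[] \<in> Pref m \<Omega>"
  by (rule Pref_kD[THEN conjunct2, of _ m \<Omega> 0]) (simp add: P_0)

lemma P_nonempty [simp]: "P k \<noteq> {}"
  using nonempty by (simp add: Pref_k_eq_image[OF \<Omega>_subset])

lemma ln_m_pos: "ln (real m) > 0"
  using m by simp

lemma C_nonneg: "C \<ge> 0"
  using ln_m_pos q by simp

lemma t_pos: "u \<in> Pref m \<Omega> \<Longrightarrow> t u > 0"
  using t_ge_1 by fastforce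

lemma ln_t_bounds:
  assumes "u \<in> Pref m \<Omega>"
  shows "0 \<le> ln (t u)" "ln (t u) \<le> C"
proof -
  show "0 \<le> ln (t u)" using t_ge_1[OF assms] by simp
  have "ln (t u) \<le> ln (real m powr (1 / (real q - 1)))"
    using t_le[OF assms] t_pos[OF assms] m by (subst ln_le_cancel_iff) auto
  then show "ln (t u) \<le> C" by simp
qed

lemma q_C_le: "real q * C \<le> 2 * ln (real m)"
proof -
  have "real q / (real q - 1) \<le> 2" using q by (simp add: field_simps)
  then have "real q / (real q - 1) * ln (real m) \<le> 2 * ln (real m)"
    using ln_m_pos by (intro mult_right_mono) auto
  then show ?thesis by simp
qed

section \<open>The masses \<open>mu\<close> of cylinders\<close>

definition mu :: "nat list \<Rightarrow> real" where
  "mu w = (\<Prod>l<length w. t (take (Suc l) w) / t (take l w) ^ q)"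

lemma mu_Nil [simp]: "mu [] = 1"
  by (simp add: mu_def)

lemma mu_snoc: "mu (w @ [a]) = mu w * (t (w @ [a]) / t w ^ q)"
proof -
  have "(\<Prod>l<length w. t (take (Suc l) (w @ [a])) / t (take l (w @ [a])) ^ q) = mu w"
    unfolding mu_def by (rule prod.cong) auto
  then show ?thesis by (simp add: mu_def)
qed

lemma mu_pos: "w \<in> Pref m \<Omega> \<Longrightarrow> mu w > 0"
proof (induction w rule: rev_induct)
  case (snoc a w)
  then show ?case using Pref_snocD[OF snoc.prems] t_pos by (simp add: mu_snoc)
qed simp

lemma sum_transition: "w \<in> Pref m \<Omega> \<Longrightarrow> (\<Sum>a\<in>children m \<Omega> w. t (w @ [a]) / t w ^ q) = 1"
  using t_pos[of w] by (simp add: t_power[symmetric] flip: sum_divide_distrib)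

lemma sum_mu_children: "w \<in> Pref m \<Omega> \<Longrightarrow> (\<Sum>a\<in>children m \<Omega> w. mu (w @ [a])) = mu w"
  by (simp only: mu_snoc sum_distrib_left[symmetric] sum_transition mult_1_right)

lemma sum_mu: "(\<Sum>w\<in>P k. mu w) = 1"
proof (induction k)
  case 0
  then show ?case by (simp add: P_0)
next
  case (Suc k)
  have "(\<Sum>w\<in>P (Suc k). mu w) = (\<Sum>w\<in>P k. mu w)"
    unfolding sum_Pref_k_Suc by (rule sum.cong) (auto dest: Pref_kD simp: sum_mu_children)
  then show ?case using Suc by simp
qed

lemma child_Pref: "a \<in> children m \<Omega> w \<Longrightarrow> w @ [a] \<in> Pref m \<Omega> \<and> w \<in> Pref m \<Omega>"
  using Pref_snocD by (auto simp: children_def)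

lemma ln_mu_snoc:
  assumes "a \<in> children m \<Omega> w"
  shows "ln (mu (w @ [a])) = ln (mu w) + ln (t (w @ [a])) - real q * ln (t w)"
  using child_Pref[OF assms] t_pos[of w] t_pos[of "w @ [a]"] mu_pos[of w]
  by (simp add: mu_snoc ln_mult ln_div ln_realpow)

text \<open>A transition probability is one term of a sum equal to 1. It is at least
  \<open>1 / m ^ 2\<close>, because its numerator is at least 1 and \<open>q * ln (t w)\<close> is
  at most \<open>q * C\<close>.\<close>

lemma mu_snoc_bounds:
  assumes "a \<in> children m \<Omega> w"
  shows "mu (w @ [a]) \<le> mu w" "ln (mu (w @ [a])) \<ge> ln (mu w) - 2 * ln (real m)"
proof -
  have w: "w @ [a] \<in> Pref m \<Omega>" "w \<in> Pref m \<Omega>" using child_Pref[OF assms] by auto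
  have "mu (w @ [a]) \<le> (\<Sum>a\<in>children m \<Omega> w. mu (w @ [a]))"
    using assms child_Pref mu_pos by (intro member_le_sum) (auto intro: less_imp_le)
  then show "mu (w @ [a]) \<le> mu w" by (simp add: sum_mu_children w)
  have "real q * ln (t w) \<le> real q * C" using ln_t_bounds[OF w(2)] by (intro mult_left_mono) auto
  then have "real q * ln (t w) \<le> 2 * ln (real m)" using q_C_le by linarith
  then show "ln (mu (w @ [a])) \<ge> ln (mu w) - 2 * ln (real m)"
    using ln_t_bounds[OF w(1)] by (simp add: ln_mu_snoc[OF assms])
qed

lemma ln_mu_bounds:
  "w \<in> Pref m \<Omega> \<Longrightarrow> ln (mu w) \<le> 0 \<and> - (2 * ln (real m) * real (length w)) \<le> ln (mu w)"
proof (induction w rule: rev_induct)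
  case (snoc a w)
  then have w: "w \<in> Pref m \<Omega>" "a \<in> children m \<Omega> w"
    using Pref_snocD[OF snoc.prems] by (auto simp: children_def)
  have "ln (mu (w @ [a])) \<le> ln (mu w)"
    using mu_snoc_bounds(1)[OF w(2)] mu_pos[OF w(1)] mu_pos[OF snoc.prems] by simp
  then show ?case
    using snoc.IH[OF w(1)] mu_snoc_bounds(2)[OF w(2)] by (simp add: algebra_simps)
qed simp

section \<open>The entropy of \<open>mu\<close>\<close>

definition H :: "nat \<Rightarrow> real" where
  "H k = - (\<Sum>w\<in>P k. mu w * ln (mu w))"

definition mean_ln_t :: "nat \<Rightarrow> real" where
  "mean_ln_t k = (\<Sum>w\<in>P k. mu w * ln (t w))"

lemma H_0 [simp]: "H 0 = 0"
  by (simp add: H_def P_0)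

text \<open>By \<open>ln_mu_snoc\<close>, \<open>ln mu - ln t\<close> at a child depends only on the
  parent, so averaging over the children with \<open>mu\<close> collapses the sum to level
  \<open>k\<close>.\<close>

lemma H_Suc: "H (Suc k) - H k = real q * mean_ln_t k - mean_ln_t (Suc k)"
proof -
  have "(\<Sum>w\<in>P (Suc k). mu w * ln (mu w) - mu w * ln (t w)) =
      (\<Sum>w\<in>P k. \<Sum>a\<in>children m \<Omega> w. mu (w @ [a]) * (ln (mu w) - real q * ln (t w)))"
    unfolding sum_Pref_k_Suc
    by (intro sum.cong refl) (simp add: ln_mu_snoc algebra_simps)
  also have "\<dots> = (\<Sum>w\<in>P k. mu w * (ln (mu w) - real q * ln (t w)))"
    by (intro sum.cong refl) (auto dest: Pref_kD simp: sum_mu_children simp flip: sum_distrib_right)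
  finally show ?thesis
    by (simp add: H_def mean_ln_t_def sum_subtractf algebra_simps sum_distrib_left)
qed

lemma mean_ln_t_bounds: "0 \<le> mean_ln_t k" "mean_ln_t k \<le> C"
proof -
  have w: "w \<in> Pref m \<Omega>" if "w \<in> P k" for w using that by (auto dest: Pref_kD)
  show "0 \<le> mean_ln_t k"
    unfolding mean_ln_t_def by (intro sum_nonneg mult_nonneg_nonneg less_imp_le[OF mu_pos] ln_t_bounds w)
  have "mean_ln_t k \<le> (\<Sum>w\<in>P k. mu w * C)"
    unfolding mean_ln_t_def by (intro sum_mono mult_left_mono less_imp_le[OF mu_pos] ln_t_bounds w)
  then show "mean_ln_t k \<le> C" by (simp only: sum_mu mult_1 flip: sum_distrib_right)
qed

lemma H_increment_le: "\<bar>H (Suc k) - H k\<bar> \<le> real q * C"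
proof -
  have "real q * mean_ln_t k \<le> real q * C" by (intro mult_left_mono mean_ln_t_bounds) auto
  moreover have "C \<le> real q * C" using mult_right_mono[of 1 "real q" C] q C_nonneg by simp
  ultimately show ?thesis
    using mean_ln_t_bounds[of "Suc k"] mult_nonneg_nonneg[OF of_nat_0_le_iff[of q] mean_ln_t_bounds(1)[of k]]
    unfolding H_Suc abs_le_iff by linarith
qed

lemma summable_H: "summable (\<lambda>k. H (Suc k) / real q ^ (k + 2))"
  by (rule linear_growth_series(1)[where g = H, OF q H_0 H_increment_le])

text \<open>By \<open>H_Suc\<close> the increments of \<open>H\<close> divided by
  \<open>q ^ Suc k\<close> are differences of consecutive terms \<open>mean_ln_t k / q ^ k\<close>.
  The series telescopes to the term at \<open>k = 0\<close>, which is
  \<open>ln (t [])\<close>.\<close>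

lemma entropy_series: "(real q - 1)^2 * (\<Sum>k. H (Suc k) / real q ^ (k + 2)) = (real q - 1) * ln (t [])"
proof -
  let ?f = "\<lambda>k. mean_ln_t k / real q ^ k"
  have "?f \<longlonglongrightarrow> 0"
  proof (rule Lim_null_comparison)
    have "norm (?f k) \<le> C / real q ^ k" for k
    proof -
      have "0 \<le> ?f k" by (simp add: mean_ln_t_bounds)
      then show ?thesis
        unfolding real_norm_def by (simp only: abs_of_nonneg divide_right_mono[OF mean_ln_t_bounds(2)] zero_le_power of_nat_0_le_iff)
    qed
    then show "eventually (\<lambda>k. norm (?f k) \<le> C / real q ^ k) sequentially"
      by (intro always_eventually allI)
    show "(\<lambda>k. C / real q ^ k) \<longlonglongrightarrow> 0"
      using q by real_asymp
  qed
  from telescope_sums'[OF this] have "(\<lambda>k. ?f k - ?f (Suc k)) sums ln (t [])"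
    by (simp add: mean_ln_t_def P_0)
  moreover have "?f k - ?f (Suc k) = (H (Suc k) - H k) / real q ^ Suc k" for k
    using q by (simp add: H_Suc field_simps)
  ultimately have "(\<Sum>k. (H (Suc k) - H k) / real q ^ Suc k) = ln (t [])"
    by (simp add: sums_iff)
  then have "(real q - 1) * (\<Sum>k. H (Suc k) / real q ^ (k + 2)) = ln (t [])"
    by (simp only: linear_growth_series(2)[where g = H, OF q H_0 H_increment_le])
  then show ?thesis by (simp only: power2_eq_square mult.assoc)
qed

section \<open>Prefix counts and their comparison with the entropy\<close>

abbreviation "N k \<equiv> real (card (P k))"

lemma N_ge_1: "N k \<ge> 1"
  using P_nonempty[of k] by (simp add: Suc_le_eq card_gt_0_iff)

lemma ln_N_0: "ln (N 0) = 0"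
  by (simp add: P_0)

lemma ln_N_increment: "\<bar>ln (N (Suc k)) - ln (N k)\<bar> \<le> ln (real m)"
proof -
  have "card (P (Suc k)) \<le> (\<Sum>u\<in>P k. m)"
    unfolding card_Pref_k_Suc by (rule sum_mono) (rule card_children_le)
  then have "N (Suc k) \<le> N k * real m" by (simp flip: of_nat_mult)
  then have "ln (N (Suc k)) \<le> ln (N k * real m)"
    using N_ge_1[of "Suc k"] N_ge_1[of k] m by (subst ln_le_cancel_iff) auto
  also have "\<dots> = ln (N k) + ln (real m)" using N_ge_1[of k] m by (simp add: ln_mult)
  finally have 1: "ln (N (Suc k)) \<le> ln (N k) + ln (real m)" .
  have "(\<Sum>u\<in>P k. 1) \<le> (\<Sum>u\<in>P k. card (children m \<Omega> u))"
  proof (rule sum_mono)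
    fix u assume "u \<in> P k"
    then have "children m \<Omega> u \<noteq> {}" using children_nonempty[OF \<Omega>_subset] by (auto dest: Pref_kD)
    then show "1 \<le> card (children m \<Omega> u)" by (simp add: Suc_le_eq card_gt_0_iff)
  qed
  then have "N k \<le> N (Suc k)" by (simp add: card_Pref_k_Suc del: of_nat_sum)
  then have "ln (N k) \<le> ln (N (Suc k))" using N_ge_1[of k] by simp
  with 1 ln_m_pos show ?thesis by linarith
qed

lemma summable_ln_N: "summable (\<lambda>k. ln (N (Suc k)) / real q ^ (k + 2))"
  by (rule linear_growth_series(1)[where g = "\<lambda>k. ln (N k)", OF q ln_N_0 ln_N_increment])

text \<open>Gibbs' inequality against the uniform distribution: \<open>gap w\<close> is
  \<open>mu w\<close> times \<open>y - 1 - ln y\<close> at \<open>y = 1 / (mu w * N k)\<close>,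
  which is nonnegative and vanishes only at \<open>y = 1\<close>, and the gaps add up to
  \<open>ln (N k) - H k\<close>.\<close>

lemma H_le_ln_N:
  shows "H k \<le> ln (N k)"
    and "H k = ln (N k) \<longleftrightarrow> (\<forall>w\<in>P k. mu w = 1 / N k)"
proof -
  define gap where "gap w = mu w * (1 / (mu w * N k) - 1 - ln (1 / (mu w * N k)))" for w
  have pos: "mu w > 0" if "w \<in> P k" for w using that mu_pos by (auto dest: Pref_kD)
  have N: "N k > 0" using N_ge_1[of k] by linarith
  have gap: "gap w \<ge> 0" if "w \<in> P k" for w
    using ln_le_minus_one[of "1 / (mu w * N k)"] pos[OF that] N by (simp add: gap_def)
  have "gap w = 1 / N k - mu w + mu w * ln (mu w) + mu w * ln (N k)" if "w \<in> P k" for w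
    using pos[OF that] N by (simp add: gap_def ln_div ln_mult algebra_simps)
  then have "(\<Sum>w\<in>P k. gap w) = (\<Sum>w\<in>P k. 1 / N k - mu w + mu w * ln (mu w) + mu w * ln (N k))"
    by simp
  also have "\<dots> = ln (N k) - H k"
    using N by (simp add: sum.distrib sum_subtractf H_def sum_mu flip: sum_distrib_right)
  finally have sum: "(\<Sum>w\<in>P k. gap w) = ln (N k) - H k" .
  with sum_nonneg[of "P k" gap] gap show "H k \<le> ln (N k)" by simp
  have "H k = ln (N k) \<longleftrightarrow> (\<forall>w\<in>P k. gap w = 0)"
    using sum sum_nonneg_eq_0_iff[of "P k" gap] gap by auto
  also have "\<dots> \<longleftrightarrow> (\<forall>w\<in>P k. mu w = 1 / N k)"
  proof (rule ball_cong[OF refl])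
    fix w assume w: "w \<in> P k"
    show "gap w = 0 \<longleftrightarrow> mu w = 1 / N k"
    proof
      assume "gap w = 0"
      then have "1 / (mu w * N k) = 1"
        using pos[OF w] N by (intro ln_eq_minus_one) (auto simp: gap_def)
      then show "mu w = 1 / N k" using pos[OF w] N by (simp add: field_simps)
    qed (use N in \<open>simp add: gap_def\<close>)
  qed
  finally show "H k = ln (N k) \<longleftrightarrow> (\<forall>w\<in>P k. mu w = 1 / N k)" .
qed

text \<open>The exponential moment of \<open>ln mu\<close> under \<open>mu\<close>; its logarithm
  has value 0 and derivative \<open>- H k\<close> at \<open>\<theta> = 0\<close>.\<close>

definition Z :: "real \<Rightarrow> nat \<Rightarrow> real" where
  "Z \<theta> k = (\<Sum>w\<in>P k. mu w powr (1 + \<theta>))"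

lemma mu_powr: "w \<in> Pref m \<Omega> \<Longrightarrow> mu w powr (1 + \<theta>) = mu w * exp (\<theta> * ln (mu w))"
  using mu_pos[of w] by (simp add: powr_add) (simp add: powr_def)

lemma Z_pos: "Z \<theta> k > 0"
  unfolding Z_def using P_nonempty mu_pos by (intro sum_pos) (auto dest!: Pref_kD simp: less_imp_neq[symmetric])

lemma ln_Z_0: "ln (Z \<theta> 0) = 0"
  by (simp add: Z_def P_0)

text \<open>One more letter lowers \<open>ln mu\<close> by an amount between 0 and
  \<open>2 * ln m\<close>, so each exponential changes by a bounded factor. This is the growth
  condition of \<open>average_chain_len\<close>.\<close>

lemma ln_Z_increment:
  assumes "\<theta> \<ge> 0"
  shows "\<bar>ln (Z \<theta> (Suc k)) - ln (Z \<theta> k)\<bar> \<le> 2 * \<theta> * ln (real m)"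
proof -
  let ?c = "exp (- (2 * \<theta> * ln (real m)))"
  \<comment> \<open>Both levels are written over the same children with the same weights
    \<open>mu (w @ [a])\<close>, which permits a termwise comparison.\<close>
  have split: "Z \<theta> k = (\<Sum>w\<in>P k. \<Sum>a\<in>children m \<Omega> w. mu (w @ [a]) * exp (\<theta> * ln (mu w)))"
    unfolding Z_def
    by (intro sum.cong refl) (auto dest!: Pref_kD simp: mu_powr sum_mu_children simp flip: sum_distrib_right)
  have split': "Z \<theta> (Suc k) = (\<Sum>w\<in>P k. \<Sum>a\<in>children m \<Omega> w. mu (w @ [a]) * exp (\<theta> * ln (mu (w @ [a]))))"
    unfolding Z_def sum_Pref_k_Suc
    by (intro sum.cong refl) (auto dest!: child_Pref simp: mu_powr)
  have "exp (\<theta> * ln (mu (w @ [a]))) \<le> exp (\<theta> * ln (mu w)) \<and>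
      ?c * exp (\<theta> * ln (mu w)) \<le> exp (\<theta> * ln (mu (w @ [a])))"
    if "a \<in> children m \<Omega> w" for w a
  proof -
    have "ln (mu (w @ [a])) \<le> ln (mu w)"
      using mu_snoc_bounds(1)[OF that] child_Pref[OF that] mu_pos by simp
    then have 1: "\<theta> * ln (mu (w @ [a])) \<le> \<theta> * ln (mu w)" using assms by (rule mult_left_mono)
    have "\<theta> * (ln (mu w) - 2 * ln (real m)) \<le> \<theta> * ln (mu (w @ [a]))"
      using mu_snoc_bounds(2)[OF that] assms by (rule mult_left_mono)
    with 1 show ?thesis by (simp add: algebra_simps flip: exp_add)
  qed
  then have step: "mu (w @ [a]) * exp (\<theta> * ln (mu (w @ [a]))) \<le> mu (w @ [a]) * exp (\<theta> * ln (mu w))"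
      "mu (w @ [a]) * exp (\<theta> * ln (mu (w @ [a]))) \<ge> ?c * (mu (w @ [a]) * exp (\<theta> * ln (mu w)))"
    if "a \<in> children m \<Omega> w" for w a
    using that child_Pref[OF that] mu_pos[of "w @ [a]"] by (auto simp: mult.left_commute[of ?c])
  have "Z \<theta> (Suc k) \<le> Z \<theta> k"
    unfolding split split' by (intro sum_mono step)
  moreover have "?c * Z \<theta> k \<le> Z \<theta> (Suc k)"
    unfolding split split' sum_distrib_left by (intro sum_mono step)
  ultimately have "ln (Z \<theta> (Suc k)) \<le> ln (Z \<theta> k)" "ln (?c * Z \<theta> k) \<le> ln (Z \<theta> (Suc k))"
    using Z_pos[of \<theta> k] Z_pos[of \<theta> "Suc k"] by (subst ln_le_cancel_iff; simp)+
  moreover have "ln (?c * Z \<theta> k) = - (2 * \<theta> * ln (real m)) + ln (Z \<theta> k)"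
    using Z_pos[of \<theta> k] by (simp add: ln_mult)
  ultimately show ?thesis by simp
qed

text \<open>Combine \<open>exp x * (1 - x) <= 1\<close> with
  \<open>(1 + x + x^2) * (1 - x) = 1 - x^3 >= 1\<close>.\<close>

lemma exp_le_quadratic:
  fixes x :: real
  assumes "x \<le> 0"
  shows "exp x \<le> 1 + x + x\<^sup>2"
proof -
  have "1 - x \<le> exp (- x)" using exp_ge_add_one_self[of "- x"] by simp
  then have "exp x * (1 - x) \<le> exp x * exp (- x)" by (intro mult_left_mono) auto
  also have "\<dots> = 1" by (simp flip: exp_add)
  also have "1 \<le> (1 + x + x\<^sup>2) * (1 - x)"
  proof -
    have "(1 + x + x\<^sup>2) * (1 - x) = 1 - x ^ 3" by (simp add: algebra_simps power2_eq_square power3_eq_cube)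
    moreover have "x ^ 3 \<le> 0" using assms by (simp add: power3_eq_cube mult_nonneg_nonpos mult_nonpos_nonpos)
    ultimately show ?thesis by simp
  qed
  finally show ?thesis using assms by (simp add: mult_le_cancel_right)
qed

text \<open>Second-order expansion in \<open>\<theta>\<close>: the linear term averages to the
  entropy, and the quadratic one is bounded through \<open>ln_mu_bounds\<close>.\<close>

lemma ln_Z_le:
  assumes "\<theta> \<ge> 0"
  shows "ln (Z \<theta> k) \<le> - \<theta> * H k + (2 * \<theta> * ln (real m))\<^sup>2 * real k ^ 2"
proof -
  let ?B = "(2 * \<theta> * ln (real m) * real k)\<^sup>2"
  have "ln (Z \<theta> k) \<le> Z \<theta> k - 1" by (rule ln_le_minus_one[OF Z_pos])
  also have "Z \<theta> k \<le> (\<Sum>w\<in>P k. mu w * (1 + \<theta> * ln (mu w) + ?B))"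
    unfolding Z_def
  proof (rule sum_mono)
    fix w assume "w \<in> P k"
    then have w: "w \<in> Pref m \<Omega>" "length w = k" by (auto dest: Pref_kD)
    have b: "ln (mu w) \<le> 0" "- (2 * ln (real m) * real k) \<le> ln (mu w)"
      using ln_mu_bounds[OF w(1)] w(2) by auto
    then have nonpos: "\<theta> * ln (mu w) \<le> 0" using assms by (intro mult_nonneg_nonpos)
    have "\<theta> * - ln (mu w) \<le> \<theta> * (2 * ln (real m) * real k)" using b assms by (intro mult_left_mono) auto
    then have "(\<theta> * - ln (mu w))\<^sup>2 \<le> (\<theta> * (2 * ln (real m) * real k))\<^sup>2"
      using nonpos by (intro power_mono) auto
    then have "(\<theta> * ln (mu w))\<^sup>2 \<le> ?B" by (simp add: mult_ac)
    then have "exp (\<theta> * ln (mu w)) \<le> 1 + \<theta> * ln (mu w) + ?B"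
      using exp_le_quadratic[OF nonpos] by linarith
    then show "mu w powr (1 + \<theta>) \<le> mu w * (1 + \<theta> * ln (mu w) + ?B)"
      using mu_pos[OF w(1)] by (simp add: mu_powr[OF w(1)])
  qed
  also have "(\<Sum>w\<in>P k. mu w * (1 + \<theta> * ln (mu w) + ?B)) = (\<Sum>w\<in>P k. mu w * (1 + ?B) + \<theta> * (mu w * ln (mu w)))"
    by (rule sum.cong) (auto simp: algebra_simps)
  also have "\<dots> = 1 + ?B - \<theta> * H k"
    by (simp add: sum.distrib H_def sum_mu flip: sum_distrib_right sum_distrib_left)
  finally show ?thesis by (simp add: power_mult_distrib)
qed

text \<open>To first order the left side is \<open>- \<theta> * (q - 1) * ln (t [])\<close> by
  \<open>entropy_series\<close>; the remainder \<open>\<theta> * (\<theta> * K)\<close> is beaten by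
  the gap \<open>\<theta> * \<Delta>\<close> for small \<open>\<theta>\<close>.\<close>

lemma exists_theta:
  assumes s: "s * ln (real m) < (real q - 1) * ln (t [])"
  obtains \<theta> where "\<theta> > 0"
    "(real q - 1)^2 * (\<Sum>k. ln (Z \<theta> (Suc k)) / real q ^ (k + 2)) < - (\<theta> * s * ln (real m))"
proof -
  define K where "K = (real q - 1)^2 * (2 * ln (real m))^2 * (\<Sum>k. real (Suc k) ^ 2 / real q ^ (k + 2))"
  have K: "K \<ge> 0"
    unfolding K_def by (intro mult_nonneg_nonneg suminf_nonneg summable_square_div_power q) auto
  define \<Delta> where "\<Delta> = (real q - 1) * ln (t []) - s * ln (real m)"
  define \<theta> where "\<theta> = \<Delta> / (K + 1)"
  have \<Delta>: "\<Delta> > 0" using s by (simp add: \<Delta>_def)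
  have \<theta>: "\<theta> > 0" using \<Delta> K by (simp add: \<theta>_def)
  have "\<theta> * K < \<Delta>" using \<Delta> K by (simp add: \<theta>_def field_simps)
  then have small: "\<theta> * (\<theta> * K) < \<theta> * \<Delta>" using \<theta> by simp
  let ?S = "\<lambda>k. real (Suc k) ^ 2 / real q ^ (k + 2)"
  have sm: "summable (\<lambda>k. - \<theta> * (H (Suc k) / real q ^ (k + 2)) + (2 * \<theta> * ln (real m))\<^sup>2 * ?S k)"
    by (intro summable_add summable_mult summable_H summable_square_div_power q)
  have "(\<Sum>k. ln (Z \<theta> (Suc k)) / real q ^ (k + 2)) \<le>
      (\<Sum>k. - \<theta> * (H (Suc k) / real q ^ (k + 2)) + (2 * \<theta> * ln (real m))\<^sup>2 * ?S k)"
  proof (rule suminf_le[OF _ _ sm])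
    show "summable (\<lambda>k. ln (Z \<theta> (Suc k)) / real q ^ (k + 2))"
      using \<theta> by (intro linear_growth_series(1)[where g = "\<lambda>k. ln (Z \<theta> k)", OF q ln_Z_0 ln_Z_increment]) simp
    fix k
    have "ln (Z \<theta> (Suc k)) / real q ^ (k + 2) \<le>
        (- \<theta> * H (Suc k) + (2 * \<theta> * ln (real m))\<^sup>2 * real (Suc k) ^ 2) / real q ^ (k + 2)"
      using \<theta> by (intro divide_right_mono ln_Z_le) auto
    then show "ln (Z \<theta> (Suc k)) / real q ^ (k + 2) \<le>
        - \<theta> * (H (Suc k) / real q ^ (k + 2)) + (2 * \<theta> * ln (real m))\<^sup>2 * ?S k"
      by (simp only: add_divide_distrib times_divide_eq_right)
  qed
  also have "\<dots> = - \<theta> * (\<Sum>k. H (Suc k) / real q ^ (k + 2)) + (2 * \<theta> * ln (real m))\<^sup>2 * (\<Sum>k. ?S k)"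
    by (simp only: suminf_add[symmetric] suminf_mult summable_mult summable_H summable_square_div_power[OF q])
  finally have "(real q - 1)^2 * (\<Sum>k. ln (Z \<theta> (Suc k)) / real q ^ (k + 2)) \<le>
      (real q - 1)^2 * (- \<theta> * (\<Sum>k. H (Suc k) / real q ^ (k + 2)) + (2 * \<theta> * ln (real m))\<^sup>2 * (\<Sum>k. ?S k))"
    by (intro mult_left_mono) auto
  also have "\<dots> = - \<theta> * ((real q - 1)^2 * (\<Sum>k. H (Suc k) / real q ^ (k + 2))) + \<theta> * (\<theta> * K)"
    unfolding K_def by (simp only: power_mult_distrib distrib_left mult_ac power2_eq_square)
  also have "\<dots> = - \<theta> * ((real q - 1) * ln (t [])) + \<theta> * (\<theta> * K)" by (simp only: entropy_series)
  also have "\<dots> < - (\<theta> * s * ln (real m))" using small by (simp add: \<Delta>_def algebra_simps)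
  finally show ?thesis using \<theta> that by blast
qed

text \<open>If \<open>mu\<close> is uniform, additivity forces \<open>N (Suc k) / N k\<close>
  children at each word of level \<open>k\<close>. Conversely, symmetry makes \<open>t\<close>, and
  with it \<open>mu\<close>, constant on levels.\<close>

lemma mu_uniform_iff: "(\<forall>k. \<forall>w\<in>P k. mu w = 1 / N k) \<longleftrightarrow> spherically_symmetric m \<Omega>"
proof
  assume uni: "\<forall>k. \<forall>w\<in>P k. mu w = 1 / N k"
  have "real (card (children m \<Omega> u)) = N (Suc k) / N k" if u: "u \<in> P k" for u k
  proof -
    have "mu u = (\<Sum>a\<in>children m \<Omega> u. mu (u @ [a]))"
      using u by (auto dest: Pref_kD simp: sum_mu_children)
    also have "\<dots> = (\<Sum>a\<in>children m \<Omega> u. 1 / N (Suc k))"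
      using u uni by (intro sum.cong refl) (simp add: snoc_Pref_k_iff)
    finally have "1 / N k = real (card (children m \<Omega> u)) / N (Suc k)" using uni u by simp
    then show ?thesis using N_ge_1[of k] N_ge_1[of "Suc k"] by (simp add: field_simps)
  qed
  moreover have "{j. j < m \<and> u @ [j] \<in> P (Suc k)} = children m \<Omega> u" if "u \<in> P k" for u k
    using that by (auto simp: snoc_Pref_k_iff children_def)
  ultimately have "card {j. j < m \<and> u @ [j] \<in> P (Suc k)} = card {j. j < m \<and> v @ [j] \<in> P (Suc k)}"
    if "u \<in> P k" "v \<in> P k" for u v k
    using that by (simp flip: of_nat_eq_iff[where 'a = real])
  then show "spherically_symmetric m \<Omega>"
    unfolding spherically_symmetric_def by blast
next
  assume sym: "spherically_symmetric m \<Omega>"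
  \<comment> \<open>Symmetry is assumed from level 1 on; level 0 has only one word.\<close>
  have card: "card (children m \<Omega> u) = card (children m \<Omega> v)" if "u \<in> P k" "v \<in> P k" for u v k
  proof (cases "k = 0")
    case True
    then show ?thesis using that by (simp add: P_0)
  next
    case False
    then have "card {j. j < m \<and> u @ [j] \<in> P (Suc k)} = card {j. j < m \<and> v @ [j] \<in> P (Suc k)}"
      using that by (intro sym[unfolded spherically_symmetric_def, rule_format]) auto
    moreover have "{j. j < m \<and> u @ [j] \<in> P (Suc k)} = children m \<Omega> u" if "u \<in> P k" for u
      using that by (auto simp: snoc_Pref_k_iff children_def)
    ultimately show ?thesis using that by simp
  qed
  \<comment> \<open>The \<open>q\<close>-th power in the equation for \<open>t\<close> contracts
    logarithmic differences by the factor \<open>q\<close>: matching children by a bijection, a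
    bound \<open>?d\<close> one level down gives \<open>?d / q\<close> here. Iterating forces
    equality.\<close>
  have close: "ln (t u) - ln (t v) \<le> C / real q ^ n" if "u \<in> P k" "v \<in> P k" for u v n k
    using that
  proof (induction n arbitrary: k u v)
    case 0
    then have "u \<in> Pref m \<Omega>" "v \<in> Pref m \<Omega>" by (auto dest: Pref_kD)
    then show ?case using ln_t_bounds[of u] ln_t_bounds[of v] by simp
  next
    case (Suc n)
    have uv: "u \<in> Pref m \<Omega>" "v \<in> Pref m \<Omega>" using Suc.prems by (auto dest: Pref_kD)
    let ?d = "C / real q ^ n"
    obtain f where f: "bij_betw f (children m \<Omega> u) (children m \<Omega> v)"
      using card[OF Suc.prems] finite_same_card_bij[OF finite_children finite_children] by blast
    have "t u ^ q = (\<Sum>a\<in>children m \<Omega> u. t (u @ [a]))" by (rule t_power[OF uv(1)])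
    also have "\<dots> \<le> (\<Sum>a\<in>children m \<Omega> u. exp ?d * t (v @ [f a]))"
    proof (rule sum_mono)
      fix a assume a: "a \<in> children m \<Omega> u"
      then have fa: "f a \<in> children m \<Omega> v" using f by (auto simp: bij_betw_def)
      have "ln (t (u @ [a])) - ln (t (v @ [f a])) \<le> ?d"
        using Suc.prems a fa by (intro Suc.IH[of _ "Suc k"]) (auto simp: snoc_Pref_k_iff)
      moreover have "t (u @ [a]) > 0" "t (v @ [f a]) > 0"
        using child_Pref[OF a] child_Pref[OF fa] t_pos by auto
      ultimately have "ln (t (u @ [a])) \<le> ln (exp ?d * t (v @ [f a]))" by (simp add: ln_mult)
      then show "t (u @ [a]) \<le> exp ?d * t (v @ [f a])"
        using \<open>t (u @ [a]) > 0\<close> \<open>t (v @ [f a]) > 0\<close> by (subst (asm) ln_le_cancel_iff) auto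
    qed
    also have "\<dots> = exp ?d * (\<Sum>a\<in>children m \<Omega> v. t (v @ [a]))"
      using sum.reindex_bij_betw[OF f, of "\<lambda>a. t (v @ [a])"] by (simp flip: sum_distrib_left)
    also have "\<dots> = exp ?d * t v ^ q" by (simp add: t_power[OF uv(2)])
    finally have "ln (t u ^ q) \<le> ln (exp ?d * t v ^ q)"
      using t_pos[OF uv(1)] t_pos[OF uv(2)] by (subst ln_le_cancel_iff) auto
    then have "real q * ln (t u) \<le> ?d + real q * ln (t v)"
      using t_pos[OF uv(1)] t_pos[OF uv(2)] by (simp add: ln_mult ln_realpow)
    then have "ln (t u) - ln (t v) \<le> ?d / real q" using q by (simp add: field_simps)
    then show ?case by (simp add: field_simps)
  qed
  have lim: "(\<lambda>n. C / real q ^ n) \<longlonglongrightarrow> 0" using q by real_asymp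
  have le: "ln (t u) \<le> ln (t v)" if "u \<in> P k" "v \<in> P k" for u v k
  proof -
    have "ln (t u) - ln (t v) \<le> 0"
      by (rule LIMSEQ_le_const[OF lim]) (use close[OF that] in blast)
    then show ?thesis by simp
  qed
  have teq: "t u = t v" if "u \<in> P k" "v \<in> P k" for u v k
  proof -
    have "ln (t u) = ln (t v)" using le that by (meson antisym)
    moreover have "t u > 0" "t v > 0" using that t_pos by (auto dest: Pref_kD)
    ultimately show ?thesis by simp
  qed
  have mueq: "mu u = mu v" if "u \<in> P k" "v \<in> P k" for u v k
    using that
  proof (induction k arbitrary: u v)
    case 0
    then show ?case by (simp add: P_0)
  next
    case (Suc k)
    then obtain u' a v' b where uv: "u = u' @ [a]" "v = v' @ [b]"
      by (metis Pref_kD append_butlast_last_id list.size(3) nat.distinct(1))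
    then have "u' \<in> P k" "v' \<in> P k" using Suc.prems by (auto simp: snoc_Pref_k_iff)
    then show ?case
      using Suc.IH teq Suc.prems unfolding uv mu_snoc by metis
  qed
  show "\<forall>k. \<forall>w\<in>P k. mu w = 1 / N k"
  proof (intro allI ballI)
    fix k w assume w: "w \<in> P k"
    have "1 = (\<Sum>v\<in>P k. mu v)" by (simp add: sum_mu)
    also have "\<dots> = (\<Sum>v\<in>P k. mu w)" using mueq[OF w] by (intro sum.cong) auto
    finally show "mu w = 1 / N k" using N_ge_1[of k] by (simp add: field_simps)
  qed
qed

text \<open>By \<open>entropy_series\<close> the difference of the two sides is a positive multiple
  of a series whose terms have constant sign by \<open>H_le_ln_N\<close>, so it vanishes only
  termwise; level 0 adds no condition, both quantities being 0 there.\<close>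

lemma series_eq_iff:
  "(real q - 1) * ln (t []) = (real q - 1)^2 * (\<Sum>k. ln (N (Suc k)) / real q ^ (k + 2)) \<longleftrightarrow>
    spherically_symmetric m \<Omega>"
proof -
  let ?g = "\<lambda>k. ln (N (Suc k)) / real q ^ (k + 2) - H (Suc k) / real q ^ (k + 2)"
  have g: "?g k = (ln (N (Suc k)) - H (Suc k)) / real q ^ (k + 2)" for k
    by (simp only: diff_divide_distrib)
  have "(real q - 1) * ln (t []) = (real q - 1)^2 * (\<Sum>k. ln (N (Suc k)) / real q ^ (k + 2)) \<longleftrightarrow>
      (\<Sum>k. ln (N (Suc k)) / real q ^ (k + 2)) - (\<Sum>k. H (Suc k) / real q ^ (k + 2)) = 0"
    using q unfolding entropy_series[symmetric] by (auto simp del: power_Suc)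
  also have "\<dots> \<longleftrightarrow> (\<Sum>k. ?g k) = 0"
    by (simp only: suminf_diff[OF summable_ln_N summable_H])
  also have "\<dots> \<longleftrightarrow> (\<forall>k. ?g k = 0)"
    by (intro suminf_eq_zero_iff summable_diff summable_ln_N summable_H)
      (simp only: g, simp add: H_le_ln_N(1))
  also have "\<dots> \<longleftrightarrow> (\<forall>k. H (Suc k) = ln (N (Suc k)))"
    using q by (simp only: g) auto
  also have "\<dots> \<longleftrightarrow> (\<forall>k. H k = ln (N k))"
    using ln_N_0 by (metis H_0 not0_implies_Suc)
  also have "\<dots> \<longleftrightarrow> spherically_symmetric m \<Omega>"
    using mu_uniform_iff by (simp only: H_le_ln_N(2))
  finally show ?thesis .
qed

end

section \<open>Dimensions of the multiplicative shift\<close>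

text \<open>The \<open>- 1\<close> translates the position \<open>i * q ^ r\<close>, counted from 1,
  into the index of a sequence counted from 0.\<close>

definition chain :: "nat \<Rightarrow> (nat \<Rightarrow> nat) \<Rightarrow> nat \<Rightarrow> nat \<Rightarrow> nat" where
  "chain q x i r = x (i * q ^ r - 1)"

text \<open>Assembles a sequence from prescribed chains; index \<open>k\<close> is position
  \<open>Suc k\<close>.\<close>

definition splice :: "nat \<Rightarrow> (nat \<Rightarrow> nat \<Rightarrow> nat) \<Rightarrow> nat \<Rightarrow> nat" where
  "splice q y k = y (core q (Suc k)) (multiplicity q (Suc k))"

lemma chain_splice:
  assumes "q \<ge> 2" "\<not> q dvd i"
  shows "chain q (splice q y) i = y i"
proof
  fix r
  have "i \<noteq> 0" using assms by (intro notI) simp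
  then have "Suc (i * q ^ r - 1) = i * q ^ r" using assms by simp
  then show "chain q (splice q y) i r = y i r"
    using assms by (simp add: chain_def splice_def core_mult_power multiplicity_mult_power)
qed

lemma chain_core: "chain q x (core q (Suc k)) (multiplicity q (Suc k)) = x k"
  by (simp add: chain_def core_power_multiplicity)

context prefix_weights
begin

section \<open>The set \<open>X\<close> and the product mass on its words\<close>

abbreviation "X \<equiv> X_set m q \<Omega>"

lemma X_iff: "x \<in> X \<longleftrightarrow> x \<in> sigma m \<and> (\<forall>i. \<not> q dvd i \<longrightarrow> chain q x i \<in> \<Omega>)"
proof -
  have "i \<ge> 1" if "\<not> q dvd i" for i using that by (cases i) auto
  then show ?thesis by (auto simp: X_set_def chain_def[abs_def])
qed

lemma X_subset: "X \<subseteq> sigma m"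
  by (auto simp: X_set_def)

text \<open>The chains may be prescribed independently of each other, which makes \<open>X\<close> a
  product of copies of \<open>\<Omega>\<close>.\<close>

lemma splice_in_X:
  assumes "\<And>i. \<not> q dvd i \<Longrightarrow> y i \<in> \<Omega>"
  shows "splice q y \<in> X"
proof -
  have "splice q y k < m" for k
  proof -
    have "y (core q (Suc k)) \<in> \<Omega>" by (rule assms, rule not_dvd_core[OF q]) simp
    then show ?thesis using \<Omega>_subset by (auto simp: splice_def sigma_def)
  qed
  then show ?thesis using assms q by (simp add: X_iff chain_splice sigma_def)
qed

lemma X_nonempty: "X \<noteq> {}"
proof -
  obtain y where "y \<in> \<Omega>" using nonempty by blast
  then have "splice q (\<lambda>_. y) \<in> X" by (intro splice_in_X)
  then show ?thesis by blast
qed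

lemma X_closed: "closed_in_sigma m X"
  unfolding closed_in_sigma_iff[OF m]
proof (intro conjI X_subset ballI impI)
  fix x assume x: "x \<in> sigma m" and approx: "\<forall>n. \<exists>y\<in>X. \<forall>k<n. x k = y k"
  have "chain q x i \<in> \<Omega>" if i: "\<not> q dvd i" for i
  proof (rule mem_closed_if_prefixes[OF m closed])
    fix n
    obtain y where y: "y \<in> X" "\<forall>k<i * q ^ n. x k = y k" using approx by blast
    have "i > 0" using i by (cases i) auto
    have "i * q ^ r - 1 < i * q ^ n" if "r < n" for r
    proof -
      have "i * q ^ r \<le> i * q ^ n" using that q by (intro mult_left_mono power_increasing) auto
      moreover have "i * q ^ r > 0" using \<open>i > 0\<close> q by simp
      ultimately show ?thesis by linarith
    qed
    then have "pre (chain q x i) n = pre (chain q y i) n"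
      using y(2) by (simp add: pre_eq_iff chain_def)
    moreover have "chain q y i \<in> \<Omega>" using y(1) i by (simp add: X_iff)
    ultimately show "pre (chain q x i) n \<in> P n" using pre_in_Pref_k[OF \<Omega>_subset] by simp
  qed
  then show "x \<in> X" using x by (simp add: X_iff)
qed

lemma chain_pre_in_P: "x \<in> X \<Longrightarrow> \<not> q dvd i \<Longrightarrow> pre (chain q x i) n \<in> P n"
  by (intro pre_in_Pref_k[OF \<Omega>_subset]) (simp add: X_iff)

lemma chain_pre_in_Pref: "x \<in> X \<Longrightarrow> \<not> q dvd i \<Longrightarrow> pre (chain q x i) n \<in> Pref m \<Omega>"
  using chain_pre_in_P Pref_kD by blast

text \<open>The transition probability of \<open>mu\<close> at position \<open>j\<close> along its
  chain.\<close>

definition wt :: "(nat \<Rightarrow> nat) \<Rightarrow> nat \<Rightarrow> real" where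
  "wt x j = t (pre (chain q x (core q j)) (Suc (multiplicity q j))) /
    t (pre (chain q x (core q j)) (multiplicity q j)) ^ q"

text \<open>The word is read as the sequence \<open>(!) u\<close>; by \<open>wt_cong\<close> the
  factors only look at entries within its length.\<close>

definition p :: "nat list \<Rightarrow> real" where
  "p u = (\<Prod>j\<in>{1..length u}. wt ((!) u) j)"

lemma chain_cong:
  assumes "i * q ^ r \<le> n" "i \<ge> 1" "\<And>k. k < n \<Longrightarrow> x k = y k"
  shows "chain q x i r = chain q y i r"
proof -
  have "i * q ^ r > 0" using assms q by simp
  then have "i * q ^ r - 1 < n" using assms(1) by linarith
  then show ?thesis using assms(3) by (simp add: chain_def)
qed

lemma power_le_of_le_multiplicity:
  assumes "r \<le> multiplicity q j"
  shows "core q j * q ^ r \<le> j"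
proof -
  have "core q j * q ^ r \<le> core q j * q ^ multiplicity q j"
    using assms q by (intro mult_left_mono power_increasing) auto
  then show ?thesis by (simp add: core_power_multiplicity)
qed

lemma wt_cong:
  assumes "j \<ge> 1" "\<And>k. k < j \<Longrightarrow> x k = y k"
  shows "wt x j = wt y j"
proof -
  have "chain q x (core q j) r = chain q y (core q j) r" if "r \<le> multiplicity q j" for r
    by (rule chain_cong[OF power_le_of_le_multiplicity[OF that] core_pos[OF assms(1)] assms(2)])
  then have "pre (chain q x (core q j)) l = pre (chain q y (core q j)) l" if "l \<le> Suc (multiplicity q j)" for l
    using that by (simp add: pre_eq_iff)
  then show ?thesis by (simp add: wt_def)
qed

lemma p_pre: "p (pre x n) = (\<Prod>j\<in>{1..n}. wt x j)"
  unfolding p_def length_pre by (intro prod.cong refl wt_cong) auto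

lemma p_pre_Suc: "p (pre x (Suc n)) = p (pre x n) * wt x (Suc n)"
  by (simp add: p_pre)

lemma wt_pos: "x \<in> X \<Longrightarrow> j \<ge> 1 \<Longrightarrow> wt x j > 0"
  using not_dvd_core[OF q] by (simp add: wt_def t_pos chain_pre_in_Pref)

lemma p_pos: "u \<in> Pref m X \<Longrightarrow> p u > 0"
  by (auto simp: Pref_def Pref_k_eq_image[OF X_subset] p_pre wt_pos intro!: prod_pos)

text \<open>A further letter of \<open>u\<close> extends exactly one chain word \<open>w\<close>.
  Each child of \<open>w\<close> yields a child of \<open>u\<close> with the corresponding factor,
  and these factors sum to 1.\<close>

lemma p_children:
  assumes "u \<in> Pref m X"
  shows "p u \<le> (\<Sum>a\<in>children m X u. p (u @ [a]))"
proof -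
  obtain x n where x: "x \<in> X" and u: "u = pre x n"
    using assms by (auto simp: Pref_def Pref_k_eq_image[OF X_subset])
  define i where "i = core q (Suc n)"
  define v where "v = multiplicity q (Suc n)"
  define w where "w = pre (chain q x i) v"
  have i: "\<not> q dvd i" unfolding i_def by (rule not_dvd_core[OF q]) simp
  have w: "w \<in> Pref m \<Omega>" unfolding w_def by (rule chain_pre_in_Pref[OF x i])
  have step: "a \<in> children m X u \<and> p (u @ [a]) = p u * (t (w @ [a]) / t w ^ q)"
    if a: "a \<in> children m \<Omega> w" for a
  proof -
    have "w @ [a] \<in> P (Suc v)"
      using a chain_pre_in_P[OF x i, of v] by (simp add: snoc_Pref_k_iff w_def)
    then obtain z where z: "z \<in> \<Omega>" "pre z (Suc v) = w @ [a]"
      by (auto simp: Pref_k_eq_image[OF \<Omega>_subset])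
    \<comment> \<open>Only the chain of \<open>i\<close> is replaced. Its positions before
      \<open>Suc n\<close> are those covered by \<open>w\<close>, an initial segment of both chains,
      so the first \<open>n\<close> letters are unchanged.\<close>
    define y where "y = splice q ((chain q x)(i := z))"
    have y: "y \<in> X" unfolding y_def using x z(1) by (intro splice_in_X) (simp add: X_iff)
    have yz: "chain q y i = z" unfolding y_def by (simp add: chain_splice[OF q i])
    have "y k = x k" if "k < n" for k
    proof (cases "core q (Suc k) = i")
      case True
      let ?r = "multiplicity q (Suc k)"
      have "i * q ^ ?r = Suc k" using core_power_multiplicity[of q "Suc k"] True by simp
      moreover have "i * q ^ v = Suc n" unfolding i_def v_def by (rule core_power_multiplicity)
      ultimately have "i * q ^ ?r < i * q ^ v" using that by simp
      then have r: "?r < v" using q by (simp add: power_strict_increasing_iff)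
      have "y k = z ?r" by (simp add: y_def splice_def True)
      also have "\<dots> = pre z (Suc v) ! ?r" using r by simp
      also have "\<dots> = chain q x i ?r" using r by (simp add: z(2) w_def nth_append)
      also have "\<dots> = x k" using chain_core[of q x k] True by simp
      finally show ?thesis .
    next
      case False
      then show ?thesis using chain_core[of q x k] by (simp add: y_def splice_def)
    qed
    then have prey: "pre y n = u" by (simp add: u pre_eq_iff)
    have zv: "pre z v = w" "z v = a" using z(2) by (auto simp: pre_Suc)
    have "y n = a" using zv(2) by (simp add: y_def splice_def flip: i_def v_def)
    then have ya: "pre y (Suc n) = u @ [a]" by (simp add: pre_Suc prey)
    then have "u @ [a] \<in> Pref_k m X (Suc n)" using pre_in_Pref_k[OF X_subset y, of "Suc n"] by simp
    then have "a \<in> children m X u" by (simp add: snoc_Pref_k_iff)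
    moreover have "p (u @ [a]) = p u * wt y (Suc n)"
      using p_pre_Suc[of y n] by (simp add: ya prey)
    moreover have "wt y (Suc n) = t (w @ [a]) / t w ^ q"
      unfolding wt_def i_def[symmetric] v_def[symmetric] yz by (simp only: z(2) zv(1))
    ultimately show ?thesis by simp
  qed
  have "p u = p u * (\<Sum>a\<in>children m \<Omega> w. t (w @ [a]) / t w ^ q)" by (simp add: sum_transition[OF w])
  also have "\<dots> = (\<Sum>a\<in>children m \<Omega> w. p (u @ [a]))"
    unfolding sum_distrib_left using step by (intro sum.cong) auto
  also have "\<dots> \<le> (\<Sum>a\<in>children m X u. p (u @ [a]))"
    using step p_pos by (intro sum_mono2) (auto simp: children_def intro: less_imp_le)
  finally show ?thesis .
qed

section \<open>Words of \<open>X\<close> as independent choices of chain words\<close>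

lemma root_not_dvd: "i \<in> roots q n \<Longrightarrow> \<not> q dvd i \<and> i \<ge> 1"
  by (simp add: roots_def)

lemma p_pre_eq_prod_mu: "p (pre x n) = (\<Prod>i\<in>roots q n. mu (pre (chain q x i) (chain_len q n i)))"
proof -
  have "p (pre x n) = (\<Prod>i\<in>roots q n. \<Prod>l<chain_len q n i. wt x (i * q ^ l))"
    unfolding p_pre by (rule prod_chains[OF q])
  also have "\<dots> = (\<Prod>i\<in>roots q n. mu (pre (chain q x i) (chain_len q n i)))"
    unfolding mu_def
    using q by (intro prod.cong refl)
      (auto simp: wt_def core_mult_power multiplicity_mult_power take_pre dest!: root_not_dvd)
  finally show ?thesis .
qed

text \<open>The restriction to \<open>roots q n\<close> places the value in the extensional product
  \<open>PiE\<close>.\<close>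

definition chains :: "nat \<Rightarrow> nat list \<Rightarrow> nat \<Rightarrow> nat list" where
  "chains n u = (\<lambda>i\<in>roots q n. pre (chain q ((!) u) i) (chain_len q n i))"

lemma chains_pre: "chains n (pre x n) = (\<lambda>i\<in>roots q n. pre (chain q x i) (chain_len q n i))"
proof -
  have "chain q ((!) (pre x n)) i r = chain q x i r" if "i \<in> roots q n" "r < chain_len q n i" for i r
  proof (rule chain_cong)
    show "i \<ge> 1" using root_not_dvd[OF that(1)] by simp
    then show "i * q ^ r \<le> n" using that(2) by (simp add: less_chain_len_iff[OF q])
  qed simp
  then show ?thesis by (auto simp: chains_def pre_eq_iff)
qed

text \<open>Injective because every position lies on a chain, surjective because points of
  \<open>\<Omega>\<close> with the chosen prefixes can be spliced.\<close>

lemma bij_betw_chains_Pref: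
  "bij_betw (chains n) (Pref_k m X n) (\<Pi>\<^sub>E i\<in>roots q n. P (chain_len q n i))"
proof (rule bij_betw_imageI)
  show "inj_on (chains n) (Pref_k m X n)"
  proof (rule inj_onI)
    fix u v assume "u \<in> Pref_k m X n" "v \<in> Pref_k m X n" and eq: "chains n u = chains n v"
    then obtain x y where xy: "u = pre x n" "v = pre y n" by (auto simp: Pref_k_eq_image[OF X_subset])
    have "x k = y k" if "k < n" for k
    proof -
      let ?i = "core q (Suc k)" and ?r = "multiplicity q (Suc k)"
      have i: "\<not> q dvd ?i" "?i \<ge> 1" using not_dvd_core[OF q, of "Suc k"] core_pos[of "Suc k" q] by auto
      have "?i \<le> Suc k" by (simp add: core_def)
      then have "?i \<in> roots q n" using i that by (simp add: roots_def)
      then have "pre (chain q x ?i) (chain_len q n ?i) = pre (chain q y ?i) (chain_len q n ?i)"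
        using fun_cong[OF eq[unfolded xy chains_pre], of ?i] by simp
      moreover have "?r < chain_len q n ?i"
        using that by (simp add: less_chain_len_iff[OF q i(2)] core_power_multiplicity)
      ultimately have "chain q x ?i ?r = chain q y ?i ?r" by (simp add: pre_eq_iff)
      then show ?thesis by (simp add: chain_core)
    qed
    then show "u = v" by (simp add: xy pre_eq_iff)
  qed
  show "chains n ` Pref_k m X n = (\<Pi>\<^sub>E i\<in>roots q n. P (chain_len q n i))"
  proof (intro equalityI subsetI)
    fix g assume "g \<in> chains n ` Pref_k m X n"
    then obtain x where "x \<in> X" "g = chains n (pre x n)" by (auto simp: Pref_k_eq_image[OF X_subset])
    then show "g \<in> (\<Pi>\<^sub>E i\<in>roots q n. P (chain_len q n i))"
      by (auto simp: chains_pre restrict_PiE_iff intro!: chain_pre_in_P dest: root_not_dvd)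
  next
    fix g assume g: "g \<in> (\<Pi>\<^sub>E i\<in>roots q n. P (chain_len q n i))"
    have "\<exists>z. z \<in> \<Omega> \<and> (i \<in> roots q n \<longrightarrow> pre z (chain_len q n i) = g i)" for i
    proof (cases "i \<in> roots q n")
      case True
      then have "g i \<in> P (chain_len q n i)" using g by (auto dest: PiE_mem)
      then show ?thesis by (auto simp: Pref_k_eq_image[OF \<Omega>_subset])
    qed (use nonempty in auto)
    then obtain y where y: "\<And>i. y i \<in> \<Omega>" "\<And>i. i \<in> roots q n \<Longrightarrow> pre (y i) (chain_len q n i) = g i"
      by metis
    have "chains n (pre (splice q y) n) = g"
      unfolding chains_pre
    proof
      fix i
      show "(\<lambda>i\<in>roots q n. pre (chain q (splice q y) i) (chain_len q n i)) i = g i"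
        using y(2)[of i] chain_splice[OF q, of i y] root_not_dvd[of i n] PiE_arb[OF g, of i]
        by (cases "i \<in> roots q n") auto
    qed
    moreover have "pre (splice q y) n \<in> Pref_k m X n"
      using y(1) by (intro pre_in_Pref_k[OF X_subset] splice_in_X)
    ultimately show "g \<in> chains n ` Pref_k m X n" by blast
  qed
qed

text \<open>Distributivity over the product set; it yields both the total mass and the exponential
  moments of \<open>p\<close>.\<close>

lemma sum_Pref_X:
  fixes F :: "nat list \<Rightarrow> real"
  shows "(\<Sum>u\<in>Pref_k m X n. \<Prod>i\<in>roots q n. F (chains n u i)) =
    (\<Prod>i\<in>roots q n. \<Sum>w\<in>P (chain_len q n i). F w)"
  using sum.reindex_bij_betw[OF bij_betw_chains_Pref, of "\<lambda>g. \<Prod>i\<in>roots q n. F (g i)" n]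
  by (simp add: prod_sum_PiE)

lemma p_eq_prod_mu:
  assumes "u \<in> Pref_k m X n"
  shows "p u = (\<Prod>i\<in>roots q n. mu (chains n u i))"
  using assms by (auto simp: Pref_k_eq_image[OF X_subset] p_pre_eq_prod_mu chains_pre)

lemma card_Pref_X: "card (Pref_k m X n) = (\<Prod>i\<in>roots q n. card (P (chain_len q n i)))"
  using bij_betw_same_card[OF bij_betw_chains_Pref, of n] by (simp add: card_PiE)

lemma sum_p: "(\<Sum>u\<in>Pref_k m X n. p u) = 1"
  using sum_Pref_X[of mu n] by (simp add: p_eq_prod_mu sum_mu)

lemma sum_p_powr: "(\<Sum>u\<in>Pref_k m X n. p u powr (1 + \<theta>)) = (\<Prod>i\<in>roots q n. Z \<theta> (chain_len q n i))"
  using sum_Pref_X[of "\<lambda>w. mu w powr (1 + \<theta>)" n] by (simp add: p_eq_prod_mu prod_powr_distrib Z_def)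

lemma minkowski_dim_X:
  "has_minkowski_dim m X ((real q - 1)^2 * (\<Sum>k. ln (N (Suc k)) / real q ^ (k + 2)) / ln (real m))"
proof (rule has_minkowski_dim_if_limit[OF m X_subset])
  have "ln (real (card (Pref_k m X n))) = (\<Sum>i\<in>roots q n. ln (N (chain_len q n i)))" for n
    unfolding card_Pref_X of_nat_prod by (rule ln_prod) auto
  then show "(\<lambda>n. ln (real (card (Pref_k m X n))) / real n) \<longlonglongrightarrow>
    (real q - 1)^2 * (\<Sum>k. ln (N (Suc k)) / real q ^ (k + 2)) / ln (real m) * ln (real m)"
    using average_chain_len[where g = "\<lambda>k. ln (N k)", OF q ln_N_0 ln_N_increment] ln_m_pos
    by simp
qed

text \<open>With \<open>S n\<close> the sum of \<open>ln (t w)\<close> over the chain words \<open>w\<close> ending at positions \<open>1, \<dots>, n\<close>,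
  the logarithm of \<open>p\<close> telescopes along \<open>n = q ^ k\<close> up to the linear term, and
  \<open>S n / n\<close> is bounded; so the linear term is attained infinitely often.\<close>

lemma ln_p_recursion:
  assumes x: "x \<in> X"
  defines "S \<equiv> \<lambda>n. \<Sum>j\<in>{1..n}. ln (t (pre (chain q x (core q j)) (Suc (multiplicity q j))))"
  shows "ln (p (pre x n)) = S n - real q * ((real n - real (n div q)) * ln (t []) + S (n div q))"
proof -
  let ?h = "\<lambda>j. ln (t (pre (chain q x (core q j)) (multiplicity q j)))"
  have "ln (p (pre x n)) = (\<Sum>j\<in>{1..n}. ln (wt x j))"
    unfolding p_pre using wt_pos[OF x] by (intro ln_prod) (auto simp: less_imp_neq[symmetric])
  also have "\<dots> = (\<Sum>j\<in>{1..n}. ln (t (pre (chain q x (core q j)) (Suc (multiplicity q j)))) - real q * ?h j)"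
  proof (rule sum.cong[OF refl])
    fix j assume "j \<in> {1..n}"
    then have "t (pre (chain q x (core q j)) l) > 0" for l
      by (intro t_pos chain_pre_in_Pref[OF x] not_dvd_core[OF q]) auto
    then show "ln (wt x j) = ln (t (pre (chain q x (core q j)) (Suc (multiplicity q j)))) - real q * ?h j"
      by (simp add: wt_def ln_div ln_realpow less_imp_neq[symmetric])
  qed
  also have "\<dots> = S n - real q * (\<Sum>j\<in>{1..n}. ?h j)"
    by (simp add: S_def sum_subtractf sum_distrib_left)
  also have "(\<Sum>j\<in>{1..n}. ?h j) = (\<Sum>j\<in>roots q n. ?h j) + (\<Sum>j\<in>{1..n div q}. ?h (q * j))"
    by (rule sum_split_multiples[OF q])
  also have "(\<Sum>j\<in>roots q n. ?h j) = (\<Sum>j\<in>roots q n. ln (t []))"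
    by (rule sum.cong) (auto simp: roots_def not_dvd_imp_multiplicity_0)
  also have "\<dots> = (real n - real (n div q)) * ln (t [])" by (simp add: card_roots[OF q])
  also have "(\<Sum>j\<in>{1..n div q}. ?h (q * j)) = S (n div q)"
    unfolding S_def
  proof (rule sum.cong[OF refl])
    fix j assume "j \<in> {1..n div q}"
    then have "multiplicity q (q * j) = Suc (multiplicity q j)"
      using q by (intro multiplicity_times_same) auto
    moreover from this have "core q (q * j) = core q j" using q by (simp add: core_def)
    ultimately show "?h (q * j) = ln (t (pre (chain q x (core q j)) (Suc (multiplicity q j))))" by simp
  qed
  finally show ?thesis .
qed

text \<open>If the mass were smaller at all lengths from \<open>M\<close> on, the averages
  \<open>A k\<close> would drop by \<open>e\<close> at every step, contradicting
  \<open>A k >= 0\<close>.\<close>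

lemma p_ge_infinitely_often:
  assumes x: "x \<in> X" and r: "(real q - 1) * ln (t []) < r * ln (real m)"
  shows "\<exists>n\<ge>M. p (pre x n) \<ge> real m powr (- real n * r)"
proof (rule ccontr)
  assume "\<not> ?thesis"
  then have less: "p (pre x n) < real m powr (- real n * r)" if "n \<ge> M" for n
    using that by (meson not_le)
  define S where "S n = (\<Sum>j\<in>{1..n}. ln (t (pre (chain q x (core q j)) (Suc (multiplicity q j)))))" for n
  \<comment> \<open>At \<open>n = q ^ Suc k\<close>, \<open>ln_p_recursion\<close> divided by
    \<open>n\<close> reads \<open>ln p / n = A (Suc k) - A k - (q - 1) * ln (t [])\<close>.\<close>
  define A where "A k = S (q ^ k) / real q ^ k" for k
  define e where "e = r * ln (real m) - (real q - 1) * ln (t [])"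
  have e: "e > 0" using r by (simp add: e_def)
  have S: "0 \<le> S n" "S n \<le> real n * C" for n
  proof -
    have b: "pre (chain q x (core q j)) (Suc (multiplicity q j)) \<in> Pref m \<Omega>" if "j \<in> {1..n}" for j
      using that by (intro chain_pre_in_Pref[OF x] not_dvd_core[OF q]) auto
    show "0 \<le> S n" unfolding S_def by (intro sum_nonneg ln_t_bounds b)
    have "S n \<le> (\<Sum>j\<in>{1..n}. C)" unfolding S_def by (intro sum_mono ln_t_bounds b)
    then show "S n \<le> real n * C" by simp
  qed
  have A: "0 \<le> A k" "A k \<le> C" for k
  proof -
    have pos: "real q ^ k > 0" using q by simp
    show "0 \<le> A k" using S(1) by (simp add: A_def)
    have "S (q ^ k) \<le> C * real q ^ k" using S(2)[of "q ^ k"] by (simp add: mult.commute)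
    then show "A k \<le> C" unfolding A_def by (simp only: pos_divide_le_eq[OF pos])
  qed
  have step: "A (Suc k) \<le> A k - e" if "k \<ge> M" for k
  proof -
    let ?n = "q ^ Suc k"
    have "k < 2 ^ k" by (rule less_exp)
    also have "\<dots> \<le> q ^ k" using q by (intro power_mono) auto
    also have "\<dots> \<le> ?n" using q by (intro power_increasing) auto
    finally have "?n \<ge> M" using that by linarith
    moreover have "p (pre x ?n) > 0"
      using pre_in_Pref_k[OF X_subset x, of ?n] by (intro p_pos) (auto dest: Pref_kD)
    ultimately have "ln (p (pre x ?n)) < ln (real m powr (- real ?n * r))"
      using less[of ?n] m by (subst ln_less_cancel_iff) auto
    then have "ln (p (pre x ?n)) < - real ?n * r * ln (real m)" by simp
    moreover have "?n div q = q ^ k" using q by simp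
    then have "ln (p (pre x ?n)) = S ?n - real q * ((real ?n - real (q ^ k)) * ln (t []) + S (q ^ k))"
      using ln_p_recursion[OF x, of ?n] by (simp only: S_def)
    moreover have "S ?n = real q ^ Suc k * A (Suc k)" "S (q ^ k) = real q ^ k * A k"
      using q by (simp_all add: A_def)
    ultimately have "real q ^ Suc k * A (Suc k) - real q * ((real q ^ Suc k - real q ^ k) * ln (t []) + real q ^ k * A k)
        < - (real q ^ Suc k) * r * ln (real m)"
      by (simp only: of_nat_power)
    then have "real q ^ Suc k * (A (Suc k) - A k + e) < 0"
      by (simp add: e_def algebra_simps)
    then have "A (Suc k) - A k + e < 0" using q by (simp add: mult_less_0_iff)
    then show ?thesis by simp
  qed
  have "A (M + d) \<le> A M - real d * e" for d
  proof (induction d)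
    case (Suc d)
    then show ?case using step[of "M + d"] by (simp add: algebra_simps)
  qed simp
  moreover obtain d where "C < real d * e" using e reals_Archimedean3 by blast
  ultimately have "A (M + d) < 0" using A(2)[of M] by (meson add_less_same_cancel1 diff_less_0_iff_less le_less_trans)
  then show False using A(1)[of "M + d"] by simp
qed

lemma hausdorff_measure_X_eq_0:
  assumes "(real q - 1) * ln (t []) < s * ln (real m)"
  shows "s > 0" "hausdorff_measure m s X = 0"
proof -
  have "0 \<le> (real q - 1) * ln (t [])" using ln_t_bounds[OF Nil_Pref] q by simp
  with assms have "0 < s * ln (real m)" by linarith
  then show s: "s > 0" using ln_m_pos by (simp add: zero_less_mult_iff)
  have "(real q - 1) * ln (t []) / ln (real m) < s" using assms ln_m_pos by (simp add: pos_divide_less_eq)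
  then obtain r where r: "r < s" and "(real q - 1) * ln (t []) / ln (real m) < r" using dense by blast
  then have "(real q - 1) * ln (t []) < r * ln (real m)" using ln_m_pos by (simp add: pos_divide_less_eq)
  then show "hausdorff_measure m s X = 0"
    using p_ge_infinitely_often p_pos s
    by (intro hausdorff_measure_eq_0[OF m X_subset r, of p]) (auto simp: sum_p intro: less_imp_le)
qed

text \<open>A Chernoff bound for the words of too large mass, with the exponential moment computed from
  the independence of the chains.\<close>

lemma hausdorff_measure_X_pos:
  assumes s: "s > 0" "s * ln (real m) < (real q - 1) * ln (t [])"
  shows "hausdorff_measure m s X \<noteq> 0"
proof (rule hausdorff_measure_pos[OF m X_closed X_nonempty s(1), of p])
  obtain \<theta> where \<theta>: "\<theta> > 0"
    "(real q - 1)^2 * (\<Sum>k. ln (Z \<theta> (Suc k)) / real q ^ (k + 2)) < - (\<theta> * s * ln (real m))"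
    using exists_theta[OF s(2)] by blast
  define L where "L = (real q - 1)^2 * (\<Sum>k. ln (Z \<theta> (Suc k)) / real q ^ (k + 2))"
  have "L < - (\<theta> * s * ln (real m))" using \<theta>(2) by (simp only: L_def)
  then obtain K where KL: "L < K" and K: "K < - (\<theta> * s * ln (real m))" using dense by blast
  \<comment> \<open>The exponential decay rate of the total mass of bad words.\<close>
  define \<eta> where "\<eta> = - (K + \<theta> * s * ln (real m))"
  have \<eta>: "\<eta> > 0" using K by (simp add: \<eta>_def)
  define a where "a n = (\<Sum>i\<in>roots q n. ln (Z \<theta> (chain_len q n i)))" for n
  define b where "b n = (\<Sum>u\<in>{u \<in> Pref_k m X n. p u > real m powr (- real n * s)}. p u)" for n
  have Pp: "p u > 0" if "u \<in> Pref_k m X n" for u n using that p_pos by (auto dest: Pref_kD)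
  have "(\<lambda>n. a n / real n) \<longlonglongrightarrow> L"
    unfolding a_def L_def using \<theta>(1)
    by (intro average_chain_len[where g = "\<lambda>k. ln (Z \<theta> k)", OF q ln_Z_0 ln_Z_increment]) simp
  then have "eventually (\<lambda>n. a n / real n < K) sequentially" using KL by (rule order_tendstoD)
  then obtain n0 where n0: "\<And>n. n \<ge> n0 \<Longrightarrow> a n / real n < K" by (auto simp: eventually_sequentially)
  have "norm (b n) \<le> exp (- \<eta>) ^ n" if n: "n \<ge> max n0 1" for n
  proof -
    let ?B = "{u \<in> Pref_k m X n. p u > real m powr (- real n * s)}"
    let ?c = "exp (real n * \<theta> * s * ln (real m))"
    have b0: "b n \<ge> 0" unfolding b_def using Pp by (intro sum_nonneg) (auto intro: less_imp_le)
    have "b n \<le> (\<Sum>u\<in>?B. ?c * p u powr (1 + \<theta>))"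
      unfolding b_def
    proof (rule sum_mono)
      fix u assume u: "u \<in> ?B"
      then have pu: "p u > 0" using Pp by auto
      have "ln (real m powr (- real n * s)) < ln (p u)" using u pu m by (subst ln_less_cancel_iff) auto
      then have "- real n * s * ln (real m) \<le> ln (p u)" by simp
      then have "\<theta> * (- real n * s * ln (real m)) \<le> \<theta> * ln (p u)" using \<theta>(1) by (intro mult_left_mono) auto
      then have "0 \<le> real n * \<theta> * s * ln (real m) + \<theta> * ln (p u)" by (simp add: algebra_simps)
      \<comment> \<open>Markov's inequality: on bad words this factor is at least 1, so inserting it
        only increases the sum.\<close>
      then have "1 \<le> ?c * p u powr \<theta>" using pu by (simp add: powr_def flip: exp_add)
      then have "p u * 1 \<le> p u * (?c * p u powr \<theta>)" using pu by (intro mult_left_mono) auto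
      then show "p u \<le> ?c * p u powr (1 + \<theta>)" using pu by (simp add: powr_add mult_ac)
    qed
    also have "\<dots> \<le> (\<Sum>u\<in>Pref_k m X n. ?c * p u powr (1 + \<theta>))" by (intro sum_mono2) auto
    also have "\<dots> = ?c * (\<Prod>i\<in>roots q n. Z \<theta> (chain_len q n i))"
      by (simp add: sum_p_powr flip: sum_distrib_left)
    also have "(\<Prod>i\<in>roots q n. Z \<theta> (chain_len q n i)) = exp (a n)"
      unfolding a_def using Z_pos by (simp add: exp_sum)
    also have "exp (a n) \<le> exp (real n * K)"
      using n0[of n] n by (simp add: field_simps)
    also have "?c * exp (real n * K) = exp (- \<eta>) ^ n"
      by (simp add: \<eta>_def algebra_simps flip: exp_add exp_of_nat_mult)
    finally show ?thesis using b0 by simp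
  qed
  then have "summable b"
    using \<eta> by (intro summable_comparison_test'[OF summable_geometric[of "exp (- \<eta>)"], where N = "max n0 1"]) auto
  then show "summable (\<lambda>n. \<Sum>u\<in>{u \<in> Pref_k m X n. p u > real m powr (- real n * s)}. p u)"
    by (simp add: b_def[abs_def])
  show "p [] = 1" by (simp add: p_def)
qed (auto intro: p_children less_imp_le[OF p_pos])

text \<open>The measure vanishes above \<open>?d\<close> and is nonzero for positive exponents below
  it. If \<open>?d = 0\<close>, the infimum runs over all positive reals and is still 0.\<close>

lemma hausdorff_dim_X: "hausdorff_dim m X = (real q - 1) * ln (t []) / ln (real m)"
proof -
  let ?d = "(real q - 1) * ln (t []) / ln (real m)"
  let ?S = "{s. s > 0 \<and> hausdorff_measure m s X = 0}"
  have up: "s \<in> ?S" if "s > ?d" for s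
    using that ln_m_pos hausdorff_measure_X_eq_0[of s] by (simp add: pos_divide_less_eq)
  have low: "?d \<le> s" if "s \<in> ?S" for s
  proof (rule ccontr)
    assume "\<not> ?d \<le> s"
    then have "s < ?d" by (simp only: not_le)
    then have "s * ln (real m) < (real q - 1) * ln (t [])" by (simp only: pos_less_divide_eq[OF ln_m_pos])
    then show False using that hausdorff_measure_X_pos[of s] by simp
  qed
  have "Inf ?S = ?d"
  proof (rule antisym)
    show "?d \<le> Inf ?S" using up[of "?d + 1"] low by (intro cInf_greatest) auto
    show "Inf ?S \<le> ?d"
    proof (rule field_le_epsilon)
      fix e :: real assume "e > 0"
      then show "Inf ?S \<le> ?d + e"
        using up[of "?d + e"] low by (intro cInf_lower) (auto intro: bdd_belowI[of _ ?d])
    qed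
  qed
  then show ?thesis by (simp add: hausdorff_dim_def)
qed

end

theorem theorem2p2:
  fixes m q :: nat and \<Omega> :: "(nat \<Rightarrow> nat) set" and t :: "nat list \<Rightarrow> real"
  assumes "m \<ge> 2" and "q \<ge> 2"
    and "\<Omega> \<noteq> {}" and "closed_in_sigma m \<Omega>"
    and "\<forall>u\<in>Pref m \<Omega>. 1 \<le> t u \<and> t u \<le> real m powr (1 / (real q - 1))"
    and "\<forall>u\<in>Pref m \<Omega>. t u ^ q = (\<Sum>j\<in>{j. j < m \<and> u @ [j] \<in> Pref m \<Omega>}. t (u @ [j]))"
  shows "hausdorff_dim m (X_set m q \<Omega>) = (real q - 1) * log (real m) (t [])
    \<and> has_minkowski_dim m (X_set m q \<Omega>)
        ((real q - 1)^2 * (\<Sum>k. log (real m) (real (card (Pref_k m \<Omega> (Suc k)))) / real q ^ (k + 2)))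
    \<and> (hausdorff_dim m (X_set m q \<Omega>) =
         (real q - 1)^2 * (\<Sum>k. log (real m) (real (card (Pref_k m \<Omega> (Suc k)))) / real q ^ (k + 2))
       \<longleftrightarrow> spherically_symmetric m \<Omega>)"
proof -
  interpret prefix_weights m q \<Omega> t
    using assms by unfold_locales (simp_all add: children_def)
  let ?M = "(real q - 1)^2 * (\<Sum>k. ln (N (Suc k)) / real q ^ (k + 2))"
  have "log (real m) (N (Suc k)) / real q ^ (k + 2) = ln (N (Suc k)) / real q ^ (k + 2) / ln (real m)" for k
    by (simp add: log_def)
  \<comment> \<open>The series was treated with natural logarithms; here the base becomes
    \<open>m\<close>.\<close>
  then have M: "(real q - 1)^2 * (\<Sum>k. log (real m) (N (Suc k)) / real q ^ (k + 2)) = ?M / ln (real m)"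
    by (simp only: suminf_divide[OF summable_ln_N] times_divide_eq_right)
  have "hausdorff_dim m X = ?M / ln (real m) \<longleftrightarrow> spherically_symmetric m \<Omega>"
    unfolding hausdorff_dim_X series_eq_iff[symmetric] using ln_m_pos by simp
  moreover have "hausdorff_dim m X = (real q - 1) * log (real m) (t [])"
    by (simp add: hausdorff_dim_X log_def)
  ultimately show ?thesis unfolding M using minkowski_dim_X by blast
qed

end
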